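(* Let $\gamma>0$. For all $t,\nu\in\mathbb{R}$, $$(Zg_{2,\gamma})(t,\nu)=2^{-\frac12}\pi^{\frac12}\,\gamma\,\vartheta_1'(0;e^{-\pi\gamma})\,e^{-\pi\gamma t^2}\,\frac{\vartheta_3(\pi(\nu-i\gamma t);e^{-\pi\gamma})}{\vartheta_4(\pi\nu;e^{-\pi\gamma})\,\vartheta_4(\pi t;e^{-\pi/\gamma})}$$ $$=\pi^{\frac12}\left(\frac{\gamma}{2}\right)^{\frac34}\vartheta_1'(0;e^{-\pi\gamma})\,\frac{(Zg_{1,\gamma})(t,\nu)}{\vartheta_4(\pi\nu;e^{-\pi\gamma})\,\vartheta_4(\pi t;e^{-\pi/\gamma})}.$$
   Context: For $\gamma>0$ and $t\in\mathbb{R}$, $g_{1,\gamma}(t)=(2\gamma)^{1/4}e^{-\pi\gamma t^2}$ and $g_{2,\gamma}(t)=\left(\frac{\pi\gamma}{2}\right)^{1/2}\frac{1}{\cosh\pi\gamma t}$. The Zak transform of a function $g$ is $(Zg)(t,\nu)=\sum_{l=-\infty}^{\infty}g(t-l)e^{2\pi i l\nu}$, $t,\nu\in\mathbb{R}$. The theta functions are, for $q\in(0,1)$ and $z\in\mathbb{C}$, $\vartheta_1(z;q)=\frac1i\sum_{n=-\infty}^{\infty}(-1)^nq^{(n+\frac12)^2}e^{(2n+1)iz}$, $\vartheta_3(z;q)=\sum_{n=-\infty}^{\infty}q^{n^2}e^{2niz}$, $\vartheta_4(z;q)=\sum_{n=-\infty}^{\infty}(-1)^nq^{n^2}e^{2niz}$.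 The prime in $\vartheta_1'$ denotes the derivative with respect to $z$. *)

theory Defs
  imports "HOL-Analysis.Analysis"
begin

definition gauss_window :: "real \<Rightarrow> real \<Rightarrow> complex" where
  "gauss_window \<gamma> t = of_real ((2 * \<gamma>) powr (1/4) * exp (- pi * \<gamma> * t\<^sup>2))"

definition sech_window :: "real \<Rightarrow> real \<Rightarrow> complex" where
  "sech_window \<gamma> t = of_real ((pi * \<gamma> / 2) powr (1/2) * (1 / cosh (pi * \<gamma> * t)))"

(* The bilateral series below are unconditional sums over the integers; for the
   windows above and for 0 < q < 1 they converge absolutely. *)

definition zak :: "(real \<Rightarrow> complex) \<Rightarrow> real \<Rightarrow> real \<Rightarrow> complex" where
  "zak g t \<nu> = (\<Sum>\<^sub>\<infinity>l\<in>(UNIV :: int set).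
     g (t - of_int l) * exp (2 * of_real pi * \<i> * of_int l * of_real \<nu>))"

(* The nome q is real and intended to lie in the open interval (0,1), so the real
   power powr is the usual one. *)

definition theta1 :: "complex \<Rightarrow> real \<Rightarrow> complex" where
  "theta1 z q = 1 / \<i> * (\<Sum>\<^sub>\<infinity>n\<in>(UNIV :: int set).
     (-1) powi n * of_real (q powr ((of_int n + 1/2)\<^sup>2)) * exp ((2 * of_int n + 1) * \<i> * z))"

definition theta3 :: "complex \<Rightarrow> real \<Rightarrow> complex" where
  "theta3 z q = (\<Sum>\<^sub>\<infinity>n\<in>(UNIV :: int set).
     of_real (q powr ((of_int n)\<^sup>2)) * exp (2 * of_int n * \<i> * z))"

definition theta4 :: "complex \<Rightarrow> real \<Rightarrow> complex" where
  "theta4 z q = (\<Sum>\<^sub>\<infinity>n\<in>(UNIV :: int set).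
     (-1) powi n * of_real (q powr ((of_int n)\<^sup>2)) * exp (2 * of_int n * \<i> * z))"

definition theta1' :: "complex \<Rightarrow> real \<Rightarrow> complex" where
  "theta1' z q = deriv (\<lambda>w. theta1 w q) z"

end

(* Poisson summation sqrt c * sum_k exp (- pi c (t - k)^2) = sum_n exp (- pi n^2 / c) cos (2 pi n t)
   is obtained without any uniqueness theorem for Fourier series.  If h_c is the difference of the
   two sides, computing Fourier coefficients gives that the integral of h_c^2 over a period is
   h_{c/2}(0), so h_c(0) >= 0 for every c.  But exchanging c and 1/c changes the sign of
   h_c(0) up to a positive factor.  Hence h_c(0) = 0, the integral vanishes and h_c = 0.
   In particular theta4 is a positive Gaussian sum on the real line.

   For z = exp (2 pi i nu) and X = exp (2 pi c t) the Zak transform of sech is a multiple of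
   sum_l z^l q^l / (1 + X q^(2l)), while theta4 (pi t) is, by Poisson summation, a multiple of
   Theta X = sum_k q^(k^2+k) X^k.  Every factor 1 + X q^(2l) divides Theta, with an explicit
   Laurent series as quotient, and rearranging the resulting double series shows that the product
   is C(z) * sum_m q^(m^2) z^m X^m.  Both sides make sense at X = -1, where only the term l = 0
   survives on the left, and this evaluates C(z) as a multiple of theta1' 0 / theta4. *)
theory Submission
  imports Defs "HOL-Probability.Characteristic_Functions"
    "HOL-Complex_Analysis.Cauchy_Integral_Formula"
begin

subsection \<open>Sums over the integers and integration\<close>

lemma summable_on_int_if_even:
  fixes f :: "int \<Rightarrow> real"
  assumes "(\<lambda>n. f (int n)) summable_on UNIV" "\<And>n. f (- n) = f n"
  shows "f summable_on UNIV"
proof -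
  have 1: "f summable_on range int"
    using assms(1) by (subst summable_on_reindex) (auto simp: o_def)
  have 2: "f summable_on range (\<lambda>n. - int n)"
    using assms by (subst summable_on_reindex) (auto simp: o_def inj_def)
  have "range int \<union> range (\<lambda>n. - int n) = UNIV"
  proof -
    have "x \<in> range int \<union> range (\<lambda>n. - int n)" for x
      by (cases x rule: int_cases2) auto
    thus ?thesis by blast
  qed
  with summable_on_union[OF 1 2] show ?thesis by simp
qed

lemma summable_on_mult_Times:
  fixes u :: "'a \<Rightarrow> 'c :: {real_normed_field, banach}"
  assumes "(\<lambda>i. norm (u i)) summable_on A" "(\<lambda>j. norm (v j)) summable_on B"
  shows "(\<lambda>(i, j). u i * v j) summable_on A \<times> B"
proof (rule abs_summable_summable)
  show "(\<lambda>x. norm (case x of (i, j) \<Rightarrow> u i * v j)) summable_on A \<times> B"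
    using assms
    by (subst Infinite_Sum.abs_summable_on_Sigma_iff)
       (auto simp: norm_mult infsum_cmult_right' infsum_nonneg abs_mult intro!: summable_on_cmult_right summable_on_cmult_left)
qed

lemma summable_on_exp_quadratic:
  fixes a b :: real
  assumes "a > 0"
  shows "(\<lambda>n::int. exp (- a * (real_of_int n)\<^sup>2 + b * \<bar>real_of_int n\<bar>)) summable_on UNIV"
proof (rule summable_on_int_if_even)
  \<comment> \<open>\<open>C\<close> is the maximum of \<open>(b + 1) * x - a * x^2\<close>;
    completing the square bounds the exponent by \<open>C - n\<close>, so a geometric series
    dominates.\<close>
  define C where "C = (b + 1)\<^sup>2 / (4 * a)"
  have le: "- a * (real n)\<^sup>2 + b * \<bar>real n\<bar> \<le> C - real n" for n
  proof -
    have "0 \<le> (2 * a * real n - (b + 1))\<^sup>2 / (4 * a)" using assms by simp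
    also have "\<dots> = C + a * (real n)\<^sup>2 - (b + 1) * real n"
      using assms by (simp add: C_def power2_eq_square field_simps)
    finally show ?thesis by (simp add: algebra_simps)
  qed
  have "summable (\<lambda>n. exp C * exp (-1) ^ n :: real)"
    by (intro summable_mult summable_geometric) auto
  hence "(\<lambda>n. exp C * exp (-1) ^ n :: real) summable_on UNIV"
    by (intro summable_nonneg_imp_summable_on) auto
  moreover have "exp C * exp (-1) ^ n = exp (C - real n)" for n
    by (simp add: exp_of_nat_mult[symmetric] mult_exp_exp exp_diff exp_minus field_simps flip: exp_of_nat_mult)
  ultimately have "(\<lambda>n. exp (C - real n)) summable_on UNIV" by simp
  thus "(\<lambda>n. exp (- a * (real_of_int (int n))\<^sup>2 + b * \<bar>real_of_int (int n)\<bar>)) summable_on UNIV"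
    by (rule summable_on_comparison_test) (use le in auto)
qed auto

text \<open>The M-test gives uniform convergence along the net of finite index sets, and continuity
  and integrals pass to uniform limits. The index type is left general so that a series over pairs
  can be integrated as well.\<close>

lemma
  fixes u :: "'i \<Rightarrow> real \<Rightarrow> real"
  assumes bound: "\<And>i t. t \<in> {a..b} \<Longrightarrow> \<bar>u i t\<bar> \<le> M i" and M: "M summable_on UNIV"
    and cont: "\<And>i. continuous_on {a..b} (u i)"
  shows continuous_on_infsum: "continuous_on {a..b} (\<lambda>t. \<Sum>\<^sub>\<infinity>i. u i t)"
    and has_sum_integral_infsum:
      "((\<lambda>i. integral {a..b} (u i)) has_sum integral {a..b} (\<lambda>t. \<Sum>\<^sub>\<infinity>i. u i t)) UNIV"
proof -
  have unif: "uniform_limit {a..b} (\<lambda>X t. \<Sum>i\<in>X. u i t) (\<lambda>t. \<Sum>\<^sub>\<infinity>i. u i t)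
      (finite_subsets_at_top UNIV)"
    by (rule Weierstrass_m_test_general[OF _ M]) (use bound in auto)
  show "continuous_on {a..b} (\<lambda>t. \<Sum>\<^sub>\<infinity>i. u i t)"
    by (rule uniform_limit_theorem[OF _ unif]) (auto intro!: continuous_on_sum cont)
  obtain I J where IJ: "\<And>X. ((\<lambda>t. \<Sum>i\<in>X. u i t) has_integral I X) {a..b}"
      "((\<lambda>t. \<Sum>\<^sub>\<infinity>i. u i t) has_integral J) {a..b}"
      "(I \<longlongrightarrow> J) (finite_subsets_at_top UNIV)"
    using uniform_limit_integral[OF unif] by (auto intro!: continuous_on_sum cont)
  have "((\<lambda>t. \<Sum>i\<in>X. u i t) has_integral (\<Sum>i\<in>X. integral {a..b} (u i))) {a..b}"
    if "finite X" for X
    using that by (intro has_integral_sum integrable_integral integrable_continuous_real cont)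
  hence "I X = (\<Sum>i\<in>X. integral {a..b} (u i))" if "finite X" for X
    using IJ(1) that has_integral_unique by blast
  hence "((\<lambda>X. \<Sum>i\<in>X. integral {a..b} (u i)) \<longlongrightarrow> J) (finite_subsets_at_top UNIV)"
    using IJ(3) by (rule_tac Lim_transform_eventually[OF IJ(3)])
      (auto intro!: eventually_finite_subsets_at_top_weakI)
  thus "((\<lambda>i. integral {a..b} (u i)) has_sum integral {a..b} (\<lambda>t. \<Sum>\<^sub>\<infinity>i. u i t)) UNIV"
    using IJ(2) by (simp add: has_sum_def integral_unique)
qed

text \<open>Unfolding: the integer translates of the unit interval tile the line, so integrals of
  all translates of \<open>f\<close> over one period add up to the integral of
  \<open>f\<close>.\<close>

lemma has_sum_integral_translates_unique:
  fixes f :: "real \<Rightarrow> real"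
  assumes f: "integrable lborel f"
    and S: "((\<lambda>k::int. integral {0..1} (\<lambda>t. f (t - of_int k))) has_sum S) UNIV"
  shows "S = (LINT x|lborel. f x)"
proof -
  define A where "A n = {- real_of_int (int_decode n)..<1 - real_of_int (int_decode n)}" for n
  have floor_A: "x \<in> A n \<longleftrightarrow> int_decode n = - \<lfloor>x\<rfloor>" for x n
    unfolding A_def by (auto simp: floor_eq_iff) linarith+
  have UN: "(\<Union>n. A n) = UNIV"
  proof -
    have "x \<in> A (int_encode (- \<lfloor>x\<rfloor>))" for x by (simp add: floor_A)
    thus ?thesis by blast
  qed
  have disj: "A i \<inter> A j = {}" if "i \<noteq> j" for i j
    using that by (auto simp: floor_A) (metis int_decode_inverse)
  have int: "set_integrable lborel B f" if "B \<in> sets borel" for B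
    using f that unfolding set_integrable_def by (intro integrable_mult_indicator) auto
  have "(LINT x:A n|lborel. f x) = integral {0..1} (\<lambda>t. f (t - of_int (int_decode n)))" for n
  proof -
    define k where "k = real_of_int (int_decode n)"
    have "(LINT x:A n|lborel. f x) = integral {-k..<1-k} f"
      unfolding A_def k_def by (intro set_borel_integral_eq_integral int) auto
    also have "\<dots> = integral {-k..1-k} f"
      by (intro integral_subset_negligible negligible_subset[OF negligible_sing[of "1-k"]]) auto
    also have "\<dots> = integral {0..1} (\<lambda>t. f (t - k))"
      using integral_shift_Icc_real[of 0 1 f "- k"] by (simp add: o_def)
    finally show ?thesis by (simp add: k_def)
  qed
  moreover have "(LINT x:(\<Union>n. A n)|lborel. f x) = (\<Sum>n. (LINT x:A n|lborel. f x))"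
    by (intro lebesgue_integral_countable_add disj int) (auto simp: A_def)
  ultimately have "(LINT x|lborel. f x) = (\<Sum>n. integral {0..1} (\<lambda>t. f (t - of_int (int_decode n))))"
    by (simp add: UN set_lebesgue_integral_def)
  moreover have "((\<lambda>n. integral {0..1} (\<lambda>t. f (t - of_int (int_decode n)))) has_sum S) UNIV"
    using S by (subst has_sum_reindex_bij_betw[OF bij_int_decode])
  ultimately show ?thesis by (simp add: has_sum_imp_sums sums_unique)
qed

text \<open>This is the real part of the characteristic function of the standard normal
  distribution, after a change of scale.\<close>

lemma has_bochner_integral_gauss_cos:
  fixes c s :: real
  assumes "c > 0"
  shows "has_bochner_integral lborel (\<lambda>x. exp (- pi * c * x\<^sup>2) * cos (2 * pi * s * x))
           (exp (- pi * s\<^sup>2 / c) / sqrt c)"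
proof -
  \<comment> \<open>Scaling by \<open>w\<close> turns \<open>exp (- x^2 / 2)\<close> into
    \<open>exp (- pi * c * x^2)\<close>, and \<open>r * w = 2 * pi * s\<close> produces the required
    frequency.\<close>
  define w where "w = sqrt (2 * pi * c)"
  define r where "r = 2 * pi * s / w"
  have w: "w > 0" "w\<^sup>2 = 2 * pi * c" using assms by (auto simp: w_def)
  interpret real_distribution std_normal_distribution by (rule real_dist_normal_dist)
  have "integrable std_normal_distribution (\<lambda>x. cos (r * x))"
    by (rule integrable_const_bound[of _ 1]) auto
  hence int: "integrable lborel (\<lambda>x. std_normal_density x * cos (r * x))"
    by (simp add: integrable_density normal_density_nonneg)
  have "(LINT x|lborel. std_normal_density x * cos (r * x)) = (LINT x|std_normal_distribution. cos (r * x))"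
    by (simp add: integral_density normal_density_nonneg)
  also have "\<dots> = (LINT x|std_normal_distribution. Re (iexp (r * x)))"
    by (simp add: Re_exp)
  also have "\<dots> = Re (char std_normal_distribution r)"
    unfolding char_def by (intro integral_Re integrable_iexp) auto
  also have "\<dots> = exp (- r\<^sup>2 / 2)"
    by (simp add: char_std_normal_distribution)
  finally have "has_bochner_integral lborel (\<lambda>x. std_normal_density x * cos (r * x)) (exp (- r\<^sup>2 / 2))"
    using int by (simp add: has_bochner_integral_iff)
  hence "has_bochner_integral lborel (\<lambda>x. std_normal_density (0 + w * x) * cos (r * (0 + w * x)))
      (exp (- r\<^sup>2 / 2) /\<^sub>R \<bar>w\<bar>)"
    using w by (subst (asm) lborel_has_bochner_integral_real_affine_iff[of w _ _ 0]) auto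
  hence "has_bochner_integral lborel (\<lambda>x. sqrt (2 * pi) * (std_normal_density (0 + w * x) * cos (r * (0 + w * x))))
      (sqrt (2 * pi) * (exp (- r\<^sup>2 / 2) /\<^sub>R \<bar>w\<bar>))"
    by (intro has_bochner_integral_mult_right) auto
  moreover have "sqrt (2 * pi) * (std_normal_density (0 + w * x) * cos (r * (0 + w * x)))
      = exp (- pi * c * x\<^sup>2) * cos (2 * pi * s * x)" for x
    using w by (simp add: std_normal_density_def r_def power_mult_distrib real_sqrt_mult mult.assoc)
  moreover have "sqrt (2 * pi) * (exp (- r\<^sup>2 / 2) /\<^sub>R \<bar>w\<bar>) = exp (- pi * s\<^sup>2 / c) / sqrt c"
  proof -
    have "- r\<^sup>2 / 2 = - pi * s\<^sup>2 / c"
      using w assms by (simp add: r_def power_divide power_mult_distrib field_simps power2_eq_square)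
    moreover have "w = sqrt (2 * pi) * sqrt c" by (simp add: w_def real_sqrt_mult)
    ultimately show ?thesis using w assms by (simp add: divide_simps)
  qed
  ultimately show ?thesis by simp
qed

text \<open>By \<open>x^2 + (x - m)^2 = 2 * (x - m / 2)^2 + m^2 / 2\<close>, a translation leaves a
  centred Gaussian of parameter \<open>2 * c\<close>. The result is again Gaussian in
  \<open>m\<close>, with the parameter halved.\<close>

lemma has_bochner_integral_gauss_translate_mult:
  fixes c m :: real
  assumes "c > 0"
  shows "has_bochner_integral lborel (\<lambda>x. exp (- pi * c * x\<^sup>2) * exp (- pi * c * (x - m)\<^sup>2))
           (exp (- pi * (c / 2) * m\<^sup>2) / sqrt (2 * c))"
proof -
  have "has_bochner_integral lborel (\<lambda>x. exp (- pi * (2 * c) * x\<^sup>2)) (1 / sqrt (2 * c))"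
    using has_bochner_integral_gauss_cos[of "2 * c" 0] assms by simp
  hence "has_bochner_integral lborel (\<lambda>x. exp (- pi * (2 * c) * (- m / 2 + 1 * x)\<^sup>2)) (1 / sqrt (2 * c))"
    by (subst (asm) lborel_has_bochner_integral_real_affine_iff[of 1 _ _ "- m / 2"]) auto
  hence "has_bochner_integral lborel
      (\<lambda>x. exp (- pi * (c / 2) * m\<^sup>2) * exp (- pi * (2 * c) * (- m / 2 + 1 * x)\<^sup>2))
      (exp (- pi * (c / 2) * m\<^sup>2) * (1 / sqrt (2 * c)))"
    by (intro has_bochner_integral_mult_right) auto
  moreover have "exp (- pi * (c / 2) * m\<^sup>2) * exp (- pi * (2 * c) * (- m / 2 + 1 * x)\<^sup>2)
      = exp (- pi * c * x\<^sup>2) * exp (- pi * c * (x - m)\<^sup>2)" for x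
    by (simp flip: exp_add) (simp add: power2_eq_square field_simps)
  ultimately show ?thesis by simp
qed

subsection \<open>Poisson summation for Gaussians\<close>

definition gauss_sum :: "real \<Rightarrow> real \<Rightarrow> real" where
  "gauss_sum c t = (\<Sum>\<^sub>\<infinity>k::int. exp (- pi * c * (t - of_int k)\<^sup>2))"

text \<open>Cosines replace complex exponentials because the coefficients are even in
  \<open>n\<close>; all functions stay real, so the integral of a square is nonnegative.\<close>

definition cos_sum :: "real \<Rightarrow> real \<Rightarrow> real" where
  "cos_sum c t = (\<Sum>\<^sub>\<infinity>n::int. exp (- pi * (of_int n)\<^sup>2 / c) * cos (2 * pi * of_int n * t))"

text \<open>Dropping \<open>t^2\<close> from the expanded square leaves a bound uniform for
  \<open>t\<close> in \<open>[-R, R]\<close>, a majorant for the M-test on a period.\<close>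

lemma gauss_translate_le:
  fixes c t R :: real and k :: int
  assumes "c > 0" "\<bar>t\<bar> \<le> R"
  shows "exp (- pi * c * (t - of_int k)\<^sup>2)
    \<le> exp (- (pi * c) * (real_of_int k)\<^sup>2 + 2 * pi * c * R * \<bar>real_of_int k\<bar>)"
proof -
  have "t * real_of_int k \<le> \<bar>t\<bar> * \<bar>real_of_int k\<bar>"
    by (simp flip: abs_mult)
  also have "\<dots> \<le> R * \<bar>real_of_int k\<bar>"
    using assms(2) by (intro mult_right_mono) auto
  finally have "t * real_of_int k \<le> R * \<bar>real_of_int k\<bar>" .
  moreover have "t\<^sup>2 \<ge> 0" by simp
  ultimately have "(real_of_int k)\<^sup>2 - 2 * (R * \<bar>real_of_int k\<bar>) \<le> (t - of_int k)\<^sup>2"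
    unfolding power2_diff by linarith
  hence "(pi * c) * ((real_of_int k)\<^sup>2 - 2 * (R * \<bar>real_of_int k\<bar>)) \<le> (pi * c) * (t - of_int k)\<^sup>2"
    using assms(1) by (intro mult_left_mono) auto
  thus ?thesis by (simp add: algebra_simps)
qed

lemma summable_on_exp_square:
  "c > 0 \<Longrightarrow> (\<lambda>n::int. exp (- pi * (real_of_int n)\<^sup>2 / c)) summable_on UNIV"
  using summable_on_exp_quadratic[of "pi / c" 0] by simp

lemma summable_on_gauss_bound:
  "c > 0 \<Longrightarrow> (\<lambda>k::int. exp (- (pi * c) * (real_of_int k)\<^sup>2 + 2 * pi * c * R * \<bar>real_of_int k\<bar>)) summable_on UNIV"
  by (rule summable_on_exp_quadratic) auto

lemma has_sum_gauss_sum: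
  assumes "c > 0"
  shows "((\<lambda>k::int. exp (- pi * c * (t - of_int k)\<^sup>2)) has_sum gauss_sum c t) UNIV"
  unfolding gauss_sum_def
  by (rule has_sum_infsum,
      rule summable_on_comparison_test[OF summable_on_gauss_bound[OF assms, of "\<bar>t\<bar>"]])
    (use gauss_translate_le[OF assms order_refl] in auto)

lemma gauss_sum_pos:
  assumes "c > 0"
  shows "gauss_sum c t > 0"
proof -
  have "(\<Sum>k\<in>{0::int}. exp (- pi * c * (t - of_int k)\<^sup>2)) \<le> gauss_sum c t"
    by (rule finite_sum_le_has_sum[OF has_sum_gauss_sum[OF assms]]) auto
  moreover have "0 < (\<Sum>k\<in>{0::int}. exp (- pi * c * (t - of_int k)\<^sup>2))" by simp
  ultimately show ?thesis by linarith
qed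

lemma continuous_on_gauss_sum: "c > 0 \<Longrightarrow> continuous_on {0..1} (gauss_sum c)"
  unfolding gauss_sum_def[abs_def]
  by (rule continuous_on_infsum[OF _ summable_on_gauss_bound[of c 1]])
     (auto intro!: continuous_intros gauss_translate_le[of c _ 1, simplified])

lemma continuous_on_cos_sum: "c > 0 \<Longrightarrow> continuous_on {0..1} (cos_sum c)"
  unfolding cos_sum_def[abs_def]
  by (rule continuous_on_infsum[OF _ summable_on_exp_square[of c]])
     (auto intro!: continuous_intros simp: abs_mult)

section \<open>Fourier coefficients and square integrals over a period\<close>

lemma cos_int_translate: "cos (2 * pi * of_int n * (t - of_int k)) = cos (2 * pi * of_int n * t)"
proof -
  have "cos (2 * pi * of_int n * (t - of_int k)) = cos (2 * pi * of_int n * t - 2 * pi * of_int (n * k))"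
    by (simp add: algebra_simps)
  thus ?thesis
    by (simp only: cos_diff sin_int_2pin cos_int_2pin mult_1_right mult_zero_right add_0_right)
qed

text \<open>The cosine has period 1, so the integrand is the periodisation of a Gaussian times a
  cosine, and unfolding reduces the coefficient to a single Gaussian integral over the line.\<close>

lemma integral_gauss_sum_cos:
  assumes "c > 0"
  shows "integral {0..1} (\<lambda>t. gauss_sum c t * cos (2 * pi * of_int n * t)) = exp (- pi * (of_int n)\<^sup>2 / c) / sqrt c"
proof -
  define f where "f x = exp (- pi * c * x\<^sup>2) * cos (2 * pi * of_int n * x)" for x
  have "((\<lambda>k::int. integral {0..1} (\<lambda>t. f (t - of_int k))) has_sum
      integral {0..1} (\<lambda>t. \<Sum>\<^sub>\<infinity>k::int. f (t - of_int k))) UNIV"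
  proof (rule has_sum_integral_infsum[OF _ summable_on_gauss_bound[OF assms, of 1]])
    fix k :: int and t :: real assume t: "t \<in> {0..1}"
    have "\<bar>f (t - of_int k)\<bar> \<le> exp (- pi * c * (t - of_int k)\<^sup>2) * 1"
      unfolding f_def abs_mult by (intro mult_mono) auto
    also have "\<dots> \<le> exp (- (pi * c) * (real_of_int k)\<^sup>2 + 2 * pi * c * 1 * \<bar>real_of_int k\<bar>)"
      using gauss_translate_le[OF assms, of t 1] t by simp
    finally show "\<bar>f (t - of_int k)\<bar> \<le> \<dots>" .
  qed (auto simp: f_def intro!: continuous_intros)
  moreover have "has_bochner_integral lborel f (exp (- pi * (of_int n)\<^sup>2 / c) / sqrt c)"
    unfolding f_def using has_bochner_integral_gauss_cos[OF assms] .
  ultimately have "integral {0..1} (\<lambda>t. \<Sum>\<^sub>\<infinity>k::int. f (t - of_int k)) = exp (- pi * (of_int n)\<^sup>2 / c) / sqrt c"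
    using has_sum_integral_translates_unique by (metis has_bochner_integral_iff)
  moreover have "(\<Sum>\<^sub>\<infinity>k::int. f (t - of_int k)) = gauss_sum c t * cos (2 * pi * of_int n * t)" for t
    unfolding f_def gauss_sum_def cos_int_translate by (rule infsum_cmult_left')
  ultimately show ?thesis by simp
qed

lemma integral_cos_int: "integral {0..1} (\<lambda>t. cos (2 * pi * of_int k * t)) = (if k = 0 then 1 else 0)"
proof (cases "k = 0")
  case False
  have "((\<lambda>t. cos (2 * pi * of_int k * t)) has_integral
      (sin (2 * pi * of_int k * 1) / (2 * pi * of_int k) - sin (2 * pi * of_int k * 0) / (2 * pi * of_int k))) {0..1}"
    using False
    by (intro fundamental_theorem_of_calculus)
       (auto intro!: derivative_eq_intros simp: has_real_derivative_iff_has_vector_derivative[symmetric])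
  thus ?thesis using False sin_int_2pin[of k] by (simp add: integral_unique)
qed auto

text \<open>The series run over all integers, where \<open>n\<close> and \<open>- n\<close> give the
  same cosine, so both indicators are kept; for \<open>n = m = 0\<close> they add up to the value
  1.\<close>

lemma integral_cos_cos:
  "integral {0..1} (\<lambda>t. cos (2 * pi * of_int n * t) * cos (2 * pi * of_int m * t))
    = ((if n = m then 1 else 0) + (if n = - m then 1 else 0)) / 2"
proof -
  have "cos (2 * pi * of_int n * t) * cos (2 * pi * of_int m * t)
     = (cos (2 * pi * of_int (n - m) * t) + cos (2 * pi * of_int (n + m) * t)) / 2" for t
    by (simp add: ring_distribs cos_add cos_diff)
  moreover have "(\<lambda>t. cos (2 * pi * of_int k * t)) integrable_on {0..1}" for k :: int
    by (intro integrable_continuous_real continuous_intros)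
  ultimately have "integral {0..1} (\<lambda>t. cos (2 * pi * of_int n * t) * cos (2 * pi * of_int m * t))
      = (integral {0..1} (\<lambda>t. cos (2 * pi * of_int (n - m) * t))
         + integral {0..1} (\<lambda>t. cos (2 * pi * of_int (n + m) * t))) / 2"
    by (simp only: integral_divide Henstock_Kurzweil_Integration.integral_add)
  thus ?thesis
    unfolding integral_cos_int by (simp add: eq_neg_iff_add_eq_0)
qed

text \<open>A Parseval relation: pairing \<open>g\<close> with the cosine series needs only the
  cosine coefficients of \<open>g\<close>. It is applied with \<open>g\<close> a cosine,
  \<open>gauss_sum c\<close> and \<open>cos_sum c\<close>.\<close>

lemma has_sum_integral_mult_cos_sum:
  assumes "c > 0" "continuous_on {0..1} g"
  shows "((\<lambda>n::int. exp (- pi * (of_int n)\<^sup>2 / c) * integral {0..1} (\<lambda>t. g t * cos (2 * pi * of_int n * t)))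
     has_sum integral {0..1} (\<lambda>t. g t * cos_sum c t)) UNIV"
proof -
  obtain B where B: "\<And>t. t \<in> {0..1} \<Longrightarrow> \<bar>g t\<bar> \<le> B"
    using compact_imp_bounded[OF compact_continuous_image[OF assms(2)]]
    unfolding bounded_iff by force
  define u where "u n t = g t * (exp (- pi * (of_int n)\<^sup>2 / c) * cos (2 * pi * of_int n * t))" for n :: int and t
  have "((\<lambda>n. integral {0..1} (u n)) has_sum integral {0..1} (\<lambda>t. \<Sum>\<^sub>\<infinity>n. u n t)) UNIV"
  proof (rule has_sum_integral_infsum)
    show "(\<lambda>n::int. B * exp (- pi * (of_int n)\<^sup>2 / c)) summable_on UNIV"
      by (intro summable_on_cmult_right summable_on_exp_square assms)
    show "\<bar>u n t\<bar> \<le> B * exp (- pi * (of_int n)\<^sup>2 / c)" if "t \<in> {0..1}" for n t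
    proof -
      have "\<bar>u n t\<bar> \<le> B * (exp (- pi * (of_int n)\<^sup>2 / c) * 1)"
        unfolding u_def abs_mult using B[OF that]
        by (intro mult_mono) auto
      thus ?thesis by simp
    qed
  qed (auto simp: u_def intro!: continuous_intros assms)
  moreover have "(\<Sum>\<^sub>\<infinity>n. u n t) = g t * cos_sum c t" for t
    unfolding u_def cos_sum_def by (rule infsum_cmult_right')
  moreover have "integral {0..1} (u n) = exp (- pi * (of_int n)\<^sup>2 / c) * integral {0..1} (\<lambda>t. g t * cos (2 * pi * of_int n * t))" for n
    unfolding u_def integral_mult_right[symmetric] by (simp only: mult_ac)
  ultimately show ?thesis by simp
qed

lemma integral_cos_sum_cos:
  assumes "c > 0"
  shows "integral {0..1} (\<lambda>t. cos_sum c t * cos (2 * pi * of_int m * t)) = exp (- pi * (of_int m)\<^sup>2 / c)"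
proof -
  have "((\<lambda>n::int. exp (- pi * (of_int n)\<^sup>2 / c) * integral {0..1} (\<lambda>t. cos (2 * pi * of_int m * t) * cos (2 * pi * of_int n * t)))
     has_sum integral {0..1} (\<lambda>t. cos (2 * pi * of_int m * t) * cos_sum c t)) UNIV"
    by (intro has_sum_integral_mult_cos_sum assms continuous_intros)
  moreover have "((\<lambda>n::int. exp (- pi * (of_int n)\<^sup>2 / c) * integral {0..1} (\<lambda>t. cos (2 * pi * of_int m * t) * cos (2 * pi * of_int n * t)))
     has_sum exp (- pi * (of_int m)\<^sup>2 / c)) UNIV"
    unfolding integral_cos_cos
    by (rule has_sum_finite_neutralI[of "{m, -m}"]) (auto simp: sum.insert_if)
  ultimately show ?thesis
    by (simp add: mult.commute has_sum_unique)
qed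

text \<open>The double series of the square is grouped by the difference \<open>m\<close> of the two
  lattice points. For fixed \<open>m\<close> the sum over \<open>k\<close> unfolds to the integral
  of two Gaussians displaced by \<open>m\<close>, and summing over \<open>m\<close> gives a Gaussian
  sum of parameter \<open>c / 2\<close>.\<close>

lemma integral_gauss_sum_square:
  assumes "c > 0"
  shows "integral {0..1} (\<lambda>t. gauss_sum c t * gauss_sum c t) = gauss_sum (c / 2) 0 / sqrt (2 * c)"
proof -
  define G where "G x = exp (- pi * c * x\<^sup>2)" for x
  define M where "M k = exp (- (pi * c) * (real_of_int k)\<^sup>2 + 2 * pi * c * 1 * \<bar>real_of_int k\<bar>)" for k
  define u where "u = (\<lambda>(m::int, k::int) t. G (t - of_int k) * G (t - of_int k - of_int m))"
  have M: "M summable_on UNIV" unfolding M_def using summable_on_gauss_bound[OF assms, of 1] .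
  have M_pos: "M k > 0" for k by (simp add: M_def)
  have G: "0 < G (t - of_int k)" "G (t - of_int k) \<le> M k" if "t \<in> {0..1}" for t k
    using gauss_translate_le[OF assms, of t 1] that by (auto simp: G_def M_def)
  \<comment> \<open>The pair \<open>(m, k)\<close> encodes the lattice points \<open>k\<close> and
    \<open>k + m\<close>.\<close>
  have "bij_betw (\<lambda>(m, k). (k, k + m)) UNIV (UNIV :: (int \<times> int) set)"
    by (rule bij_betwI[of _ _ _ "\<lambda>(j, k). (k - j, j)"]) auto
  note reindex = this
  have "(\<lambda>(j, k). M j * M k) summable_on UNIV \<times> UNIV"
    using M M_pos by (intro summable_on_mult_Times) (auto simp: less_imp_le)
  hence M2: "(\<lambda>(m, k). M k * M (k + m)) summable_on UNIV"
    using summable_on_reindex_bij_betw[OF reindex, of "\<lambda>(j, k). M j * M k"]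
    by (simp add: case_prod_unfold)
  have "((\<lambda>p. integral {0..1} (u p)) has_sum integral {0..1} (\<lambda>t. \<Sum>\<^sub>\<infinity>p. u p t)) UNIV"
  proof (rule has_sum_integral_infsum[OF _ M2])
    fix p :: "int \<times> int" and t :: real assume "t \<in> {0..1}"
    thus "\<bar>u p t\<bar> \<le> (case p of (m, k) \<Rightarrow> M k * M (k + m))"
      using G(1)[of t "snd p"] G(1)[of t "fst p + snd p"] G(2)[of t "snd p"] G(2)[of t "fst p + snd p"]
      by (auto simp: u_def abs_mult case_prod_unfold algebra_simps intro!: mult_mono)
  qed (auto simp: u_def G_def case_prod_unfold intro!: continuous_intros)
  moreover have "(\<Sum>\<^sub>\<infinity>p. u p t) = gauss_sum c t * gauss_sum c t" if t: "t \<in> {0..1}" for t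
  proof -
    have Gs: "(\<lambda>k. G (t - of_int k)) summable_on UNIV"
      by (rule summable_on_comparison_test[OF M]) (use G[OF t] in \<open>auto simp: less_imp_le\<close>)
    have "(\<Sum>\<^sub>\<infinity>p. u p t) = (\<Sum>\<^sub>\<infinity>p. case p of (j, k) \<Rightarrow> G (t - of_int j) * G (t - of_int k))"
      using infsum_reindex_bij_betw[OF reindex, of "\<lambda>(j, k). G (t - of_int j) * G (t - of_int k)"]
      by (simp add: u_def case_prod_unfold algebra_simps)
    also have "\<dots> = infsum (\<lambda>(j, k). G (t - of_int j) * G (t - of_int k)) (UNIV \<times> UNIV)"
      by simp
    also have "\<dots> = (\<Sum>\<^sub>\<infinity>j. \<Sum>\<^sub>\<infinity>k. G (t - of_int j) * G (t - of_int k))"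
      using Gs G(1)[OF t]
      by (intro infsum_Sigma'_banach[symmetric] summable_on_mult_Times) (auto simp: less_imp_le)
    also have "\<dots> = gauss_sum c t * gauss_sum c t"
      by (simp add: infsum_cmult_right' infsum_cmult_left' gauss_sum_def G_def)
    finally show ?thesis .
  qed
  hence "integral {0..1} (\<lambda>t. \<Sum>\<^sub>\<infinity>p. u p t) = integral {0..1} (\<lambda>t. gauss_sum c t * gauss_sum c t)"
    by (intro Henstock_Kurzweil_Integration.integral_cong) auto
  ultimately have *: "((\<lambda>p. integral {0..1} (u p)) has_sum integral {0..1} (\<lambda>t. gauss_sum c t * gauss_sum c t)) (UNIV \<times> UNIV)"
    by simp
  have "((\<lambda>k. integral {0..1} (u (m, k))) has_sum exp (- pi * (c / 2) * (of_int m)\<^sup>2) / sqrt (2 * c)) UNIV" for m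
  proof -
    define f where "f x = G x * G (x - of_int m)" for x
    have sm: "(\<lambda>k::int. integral {0..1} (\<lambda>t. f (t - of_int k))) summable_on UNIV"
      using summable_on_SigmaD1[of "\<lambda>m k. integral {0..1} (u (m, k))" UNIV "\<lambda>_. UNIV" m] * 
      by (auto simp: u_def f_def case_prod_unfold dest: has_sum_imp_summable)
    have "has_bochner_integral lborel f (exp (- pi * (c / 2) * (of_int m)\<^sup>2) / sqrt (2 * c))"
      unfolding f_def G_def by (rule has_bochner_integral_gauss_translate_mult[OF assms])
    hence "integrable lborel f" "(LINT x|lborel. f x) = exp (- pi * (c / 2) * (of_int m)\<^sup>2) / sqrt (2 * c)"
      by (auto simp: has_bochner_integral_iff)
    thus ?thesis
      using has_sum_integral_translates_unique[of f] has_sum_infsum[OF sm] by (simp add: u_def f_def)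
  qed
  with * have "((\<lambda>m. exp (- pi * (c / 2) * (of_int m)\<^sup>2) / sqrt (2 * c)) has_sum
      integral {0..1} (\<lambda>t. gauss_sum c t * gauss_sum c t)) UNIV"
    by (rule has_sum_SigmaD)
  hence "integral {0..1} (\<lambda>t. gauss_sum c t * gauss_sum c t) = (\<Sum>\<^sub>\<infinity>m::int. exp (- pi * (c / 2) * (of_int m)\<^sup>2) / sqrt (2 * c))"
    by (simp add: infsumI)
  also have "\<dots> = gauss_sum (c / 2) 0 / sqrt (2 * c)"
    unfolding divide_inverse infsum_cmult_left' gauss_sum_def by simp
  finally show ?thesis .
qed

text \<open>Squaring the coefficient \<open>exp (- pi * n^2 / c)\<close> halves the parameter, so
  both \<open>sqrt c\<close> times the mixed integral and the integral of \<open>C * C\<close> equal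
  \<open>cos_sum (c / 2) 0\<close>. In the expanded square they enter with factors -2 and 1, leaving
  -1.\<close>

lemma integral_gauss_sum_diff_cos_sum_square:
  assumes "c > 0"
  shows "integral {0..1} (\<lambda>t. (sqrt c * gauss_sum c t - cos_sum c t)\<^sup>2)
    = sqrt (c / 2) * gauss_sum (c / 2) 0 - cos_sum (c / 2) 0"
proof -
  define G C where "G = gauss_sum c" and "C = cos_sum c"
  have cont: "continuous_on {0..1} G" "continuous_on {0..1} C"
    using assms continuous_on_gauss_sum continuous_on_cos_sum by (auto simp: G_def C_def)
  have e: "exp (- pi * (of_int n)\<^sup>2 / c) * exp (- pi * (of_int n)\<^sup>2 / c) = exp (- pi * (of_int n)\<^sup>2 / (c / 2))" for n :: int
    by (simp flip: exp_add)
  have GC: "sqrt c * integral {0..1} (\<lambda>t. G t * C t) = cos_sum (c / 2) 0"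
  proof -
    have "((\<lambda>n::int. exp (- pi * (of_int n)\<^sup>2 / c) * (exp (- pi * (of_int n)\<^sup>2 / c) / sqrt c)) has_sum integral {0..1} (\<lambda>t. G t * C t)) UNIV"
      using has_sum_integral_mult_cos_sum[OF assms cont(1)] integral_gauss_sum_cos[OF assms] by (simp add: G_def C_def)
    from has_sum_cmult_right[OF this, of "sqrt c"]
    have "((\<lambda>n::int. exp (- pi * (of_int n)\<^sup>2 / (c / 2))) has_sum sqrt c * integral {0..1} (\<lambda>t. G t * C t)) UNIV"
      using assms unfolding e[symmetric] by simp
    thus ?thesis by (simp add: cos_sum_def infsumI)
  qed
  have CC: "integral {0..1} (\<lambda>t. C t * C t) = cos_sum (c / 2) 0"
  proof -
    have "((\<lambda>n::int. exp (- pi * (of_int n)\<^sup>2 / c) * exp (- pi * (of_int n)\<^sup>2 / c)) has_sum integral {0..1} (\<lambda>t. C t * C t)) UNIV"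
      using has_sum_integral_mult_cos_sum[OF assms cont(2)] integral_cos_sum_cos[OF assms] by (simp add: C_def)
    thus ?thesis unfolding e cos_sum_def by (simp add: infsumI)
  qed
  have int: "(\<lambda>t. G t * G t) integrable_on {0..1}" "(\<lambda>t. G t * C t) integrable_on {0..1}" "(\<lambda>t. C t * C t) integrable_on {0..1}"
    by (intro integrable_continuous_real continuous_intros cont)+
  have "(\<lambda>t. (sqrt c * G t - C t)\<^sup>2) = (\<lambda>t. c * (G t * G t) - 2 * sqrt c * (G t * C t) + C t * C t)"
    using assms by (auto simp: power2_eq_square algebra_simps)
  hence "integral {0..1} (\<lambda>t. (sqrt c * G t - C t)\<^sup>2) = c * integral {0..1} (\<lambda>t. G t * G t)
      - 2 * (sqrt c * integral {0..1} (\<lambda>t. G t * C t)) + integral {0..1} (\<lambda>t. C t * C t)"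
    unfolding integral_mult_right[symmetric] mult.assoc[symmetric]
    by (simp only:, subst Henstock_Kurzweil_Integration.integral_add Henstock_Kurzweil_Integration.integral_diff;
      auto intro!: integrable_continuous_real continuous_intros cont simp: mult.assoc)+
  also have "c * integral {0..1} (\<lambda>t. G t * G t) = sqrt (c / 2) * gauss_sum (c / 2) 0"
  proof -
    have "c / sqrt (2 * c) = sqrt (c / 2)"
      using assms by (simp add: real_sqrt_mult real_sqrt_divide divide_simps)
    thus ?thesis using integral_gauss_sum_square[OF assms] by (simp add: G_def flip: \<open>c / sqrt (2 * c) = _\<close>)
  qed
  finally show ?thesis unfolding GC CC by (simp add: G_def C_def)
qed

text \<open>The difference of the two sides is the integral of a square, taken at parameter
  \<open>2 * c\<close>.\<close>

lemma cos_sum_le_gauss_sum_0: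
  assumes "c > 0"
  shows "cos_sum c 0 \<le> sqrt c * gauss_sum c 0"
proof -
  have "0 \<le> integral {0..1} (\<lambda>t. (sqrt (2 * c) * gauss_sum (2 * c) t - cos_sum (2 * c) t)\<^sup>2)"
    using assms
    by (intro Henstock_Kurzweil_Integration.integral_nonneg integrable_continuous_real
      continuous_intros continuous_on_gauss_sum continuous_on_cos_sum) auto
  thus ?thesis
    using integral_gauss_sum_diff_cos_sum_square[of "2 * c"] assms by simp
qed

text \<open>At 0 every cosine is 1, so both are the same Gaussian series with reciprocal
  parameters.\<close>

lemma cos_sum_0_inverse: "cos_sum (inverse c) 0 = gauss_sum c 0"
  by (simp add: cos_sum_def gauss_sum_def field_simps)

lemma gauss_sum_0_eq_cos_sum_0:
  assumes "c > 0"
  shows "sqrt c * gauss_sum c 0 = cos_sum c 0"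
proof (rule antisym)
  \<comment> \<open>The inequality at \<open>inverse c\<close>, where the two series exchange roles,
    is the reverse inequality up to the factor \<open>sqrt c\<close>.\<close>
  have "gauss_sum c 0 \<le> sqrt (inverse c) * cos_sum c 0"
    using cos_sum_le_gauss_sum_0[of "inverse c"] cos_sum_0_inverse[of c] cos_sum_0_inverse[of "inverse c"] assms by simp
  hence "sqrt c * gauss_sum c 0 \<le> sqrt c * (sqrt (inverse c) * cos_sum c 0)"
    using assms by (intro mult_left_mono) auto
  thus "sqrt c * gauss_sum c 0 \<le> cos_sum c 0"
    using assms by (simp add: mult.assoc[symmetric] flip: real_sqrt_mult)
qed (rule cos_sum_le_gauss_sum_0[OF assms])

text \<open>The integral of \<open>h^2\<close> is the discrepancy at 0 for \<open>c / 2\<close>,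
  which is zero. Continuity gives \<open>h = 0\<close> on one period and periodicity extends this to
  the line.\<close>

theorem gauss_sum_eq_cos_sum:
  assumes "c > 0"
  shows "sqrt c * gauss_sum c t = cos_sum c t"
proof -
  define h where "h t = sqrt c * gauss_sum c t - cos_sum c t" for t
  have "integral {0..1} (\<lambda>t. (h t)\<^sup>2) = 0"
    unfolding h_def using integral_gauss_sum_diff_cos_sum_square[OF assms] gauss_sum_0_eq_cos_sum_0[of "c / 2"] assms by simp
  moreover have "continuous_on {0..1} (\<lambda>t. (h t)\<^sup>2)"
    unfolding h_def by (intro continuous_intros continuous_on_gauss_sum continuous_on_cos_sum assms)
  ultimately have h0: "h t = 0" if "t \<in> {0..1}" for t
    using integral_eq_0_iff[of 0 1 "\<lambda>t. (h t)\<^sup>2"] that by auto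
  have "gauss_sum c (t - of_int k) = gauss_sum c t" for k
    unfolding gauss_sum_def
    by (rule infsum_reindex_bij_witness[of _ "\<lambda>j. j - k" "\<lambda>j. j + k"]) (auto simp: algebra_simps)
  moreover have "cos_sum c (t - of_int k) = cos_sum c t" for k
    unfolding cos_sum_def by (simp only: cos_int_translate)
  ultimately have "h t = h (t - of_int \<lfloor>t\<rfloor>)" by (simp add: h_def)
  also have "\<dots> = 0" by (rule h0) (auto simp: le_floor_iff, linarith)
  finally show ?thesis by (simp add: h_def)
qed

subsection \<open>A Kronecker-type series as a quotient of theta series\<close>

text \<open>With \<open>r = exp (- a)\<close> the quadratic decay beats any linear exponent. Only a
  lower bound on \<open>e\<close> is asked, so one test serves \<open>n^2\<close>,
  \<open>n^2 + n\<close> and \<open>n^2 + |n|\<close>.\<close>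

lemma abs_summable_on_powi_quadratic_exp:
  fixes w :: "int \<Rightarrow> 'a :: real_normed_vector"
  assumes r: "0 < r" "r < 1"
    and e: "\<And>n. e n \<ge> n\<^sup>2 - d * \<bar>n\<bar>"
    and w: "\<And>n. norm (w n) \<le> B * r powi e n * exp (b * \<bar>real_of_int n\<bar>)"
  shows "(\<lambda>n. norm (w n)) summable_on UNIV"
proof (rule Infinite_Sum.abs_summable_on_comparison_test')
  define a where "a = - ln r"
  have a: "a > 0" "r = exp (- a)" using r by (auto simp: a_def ln_less_zero_iff)
  show "(\<lambda>n::int. \<bar>B\<bar> * exp (- a * (of_int n)\<^sup>2 + (b + a * of_int d) * \<bar>of_int n\<bar>)) summable_on UNIV"
    by (intro summable_on_cmult_right summable_on_exp_quadratic a)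
  fix n :: int
  have "norm (w n) \<le> B * (r powi e n * exp (b * \<bar>real_of_int n\<bar>))"
    using w[of n] by (simp add: mult_ac)
  also have "\<dots> \<le> \<bar>B\<bar> * (r powi e n * exp (b * \<bar>real_of_int n\<bar>))"
    using r by (intro mult_right_mono) auto
  also have "r powi e n * exp (b * \<bar>real_of_int n\<bar>) = exp (- a * of_int (e n) + b * \<bar>real_of_int n\<bar>)"
    using r by (simp add: powr_def exp_diff exp_minus a_def divide_inverse flip: powr_real_of_int')
      (simp add: exp_add mult_ac)
  also have "\<dots> \<le> exp (- a * (of_int n)\<^sup>2 + (b + a * of_int d) * \<bar>of_int n\<bar>)"
  proof -
    have "real_of_int (n\<^sup>2 - d * \<bar>n\<bar>) \<le> real_of_int (e n)" using e[of n] by linarith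
    hence "a * ((of_int n)\<^sup>2 - of_int d * \<bar>of_int n\<bar>) \<le> a * of_int (e n)"
      using a by (intro mult_left_mono) auto
    thus ?thesis by (simp add: algebra_simps)
  qed
  finally show "norm (w n) \<le> \<bar>B\<bar> * exp (- a * (of_int n)\<^sup>2 + (b + a * of_int d) * \<bar>of_int n\<bar>)"
    by (simp add: mult_left_mono)
qed

lemma abs_summable_on_powi_quadratic:
  fixes w :: "int \<Rightarrow> 'a :: real_normed_vector"
  assumes r: "0 < r" "r < 1" and y: "y > 0"
    and e: "\<And>n. e n \<ge> n\<^sup>2 - d * \<bar>n\<bar>"
    and w: "\<And>n. norm (w n) \<le> B * r powi e n * y powi n"
  shows "(\<lambda>n. norm (w n)) summable_on UNIV"
proof (rule abs_summable_on_powi_quadratic_exp[OF r e])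
  fix n :: int
  have "ln y * of_int n \<le> \<bar>ln y\<bar> * \<bar>real_of_int n\<bar>"
    by (simp flip: abs_mult)
  hence "y powi n \<le> exp (\<bar>ln y\<bar> * \<bar>real_of_int n\<bar>)"
    using y by (simp add: powr_def mult.commute flip: powr_real_of_int')
  moreover have "norm (w n) \<le> \<bar>B\<bar> * r powi e n * y powi n"
    using r y by (intro order_trans[OF w] mult_right_mono) auto
  ultimately show "norm (w n) \<le> \<bar>B\<bar> * r powi e n * exp (\<bar>ln y\<bar> * \<bar>real_of_int n\<bar>)"
    using r by (elim order_trans) (intro mult_left_mono, auto)
qed

section \<open>Division of the theta series by its linear factors\<close>

locale nome =
  fixes q :: complex
  assumes q_nz: "q \<noteq> 0" and q_less_1: "norm q < 1"
begin

text \<open>These are the terms of \<open>Theta (-1)\<close>.\<close>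

definition alt :: "int \<Rightarrow> complex" where
  "alt k = (-1) powi k * q powi (k\<^sup>2 + k)"

definition alt_sum :: "int \<Rightarrow> complex" where
  "alt_sum j = (\<Sum>\<^sub>\<infinity>k\<in>{..<j}. alt k)"

text \<open>With \<open>Y = exp (2 i z)\<close> this is the classical second theta function of
  \<open>z\<close>, up to the factor \<open>q^(1/4) exp (i z)\<close>.\<close>

definition Theta :: "complex \<Rightarrow> complex" where
  "Theta Y = (\<Sum>\<^sub>\<infinity>k. q powi (k\<^sup>2 + k) * Y powi k)"

definition Quot :: "complex \<Rightarrow> complex" where
  "Quot Y = (\<Sum>\<^sub>\<infinity>j. (- Y) powi (j - 1) * alt_sum j)"

lemma norm_q: "0 < norm q" "norm q < 1"
  using q_nz q_less_1 by auto

lemma norm_alt: "norm (alt k) = norm q powi (k\<^sup>2 + k)"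
  by (simp add: alt_def norm_mult norm_power_int)

lemma abs_summable_alt: "(\<lambda>k. norm (alt k)) summable_on UNIV"
  by (rule abs_summable_on_powi_quadratic[OF norm_q, where y = 1 and d = 1 and B = 1 and e = "\<lambda>k. k\<^sup>2 + k"])
     (auto simp: norm_alt)

lemma summable_alt: "alt summable_on A"
  by (rule summable_on_subset_banach[OF abs_summable_summable[OF abs_summable_alt]]) auto

text \<open>The reflection \<open>k -> -1 - k\<close> fixes \<open>k^2 + k\<close> and flips the
  parity of \<open>k\<close>. This is the zero of \<open>Theta\<close> at -1.\<close>

lemma infsum_alt: "(\<Sum>\<^sub>\<infinity>k. alt k) = 0"
proof -
  have "(\<Sum>\<^sub>\<infinity>k. alt k) = (\<Sum>\<^sub>\<infinity>k. - alt k)"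
  proof (rule infsum_reindex_bij_witness[of _ "\<lambda>k. -1 - k" "\<lambda>k. -1 - k"])
    fix k :: int
    have 1: "(-1 - k)\<^sup>2 + (-1 - k) = k\<^sup>2 + k" by (simp add: power2_eq_square algebra_simps)
    have 2: "(-1) powi (-1 - k) = - ((-1) powi k :: complex)"
      by (simp add: power_int_minus_one_minus power_int_diff power_int_add power_int_minus power_int_minus_left)
    show "- alt (-1 - k) = alt k"
      unfolding alt_def 1 2 by simp
  qed auto
  thus ?thesis by (simp add: infsum_uminus)
qed

lemma alt_sum_Suc: "alt_sum (j + 1) = alt_sum j + alt j"
proof -
  have "{..<j + 1} = {..<j} \<union> {j}" by auto
  thus ?thesis unfolding alt_sum_def
    by (simp only:, subst infsum_Un_disjoint) (auto intro: summable_alt)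
qed

text \<open>For \<open>j >= 0\<close> this trades a sum containing the large terms near 0 for a
  small tail.\<close>

lemma alt_sum_eq: "alt_sum j = - (\<Sum>\<^sub>\<infinity>k\<in>{j..}. alt k)"
proof -
  have "(\<Sum>\<^sub>\<infinity>k\<in>{..<j} \<union> {j..}. alt k) = alt_sum j + (\<Sum>\<^sub>\<infinity>k\<in>{j..}. alt k)"
    unfolding alt_sum_def by (intro infsum_Un_disjoint summable_alt) auto
  moreover have "{..<j} \<union> {j..} = UNIV" by auto
  ultimately show ?thesis using infsum_alt by (simp add: eq_neg_iff_add_eq_0)
qed

text \<open>The upper tail is used for \<open>j >= 0\<close> and the lower one for
  \<open>j < 0\<close>, so only small terms occur. The surplus \<open>|j|\<close> beyond
  \<open>j^2\<close> secures convergence in \<open>Kron_eq_product\<close>, where a factor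
  \<open>q^(-j^2)\<close> appears.\<close>

lemma norm_alt_sum_le:
  obtains B where "\<And>j. norm (alt_sum j) \<le> B * norm q powi (j\<^sup>2 + \<bar>j\<bar>)"
proof -
  define r where "r = norm q"
  have r: "r > 0" "r < 1" using q_nz q_less_1 by (auto simp: r_def)
  define g where "g i = r powi (\<bar>i\<bar> - 1)" for i :: int
  have g: "g summable_on UNIV"
  proof (rule summable_on_int_if_even)
    have "(\<lambda>n. inverse r * r ^ n) summable_on UNIV"
      using r by (intro summable_nonneg_imp_summable_on summable_mult summable_geometric) auto
    thus "(\<lambda>n. g (int n)) summable_on UNIV"
      using r by (simp add: g_def power_int_diff divide_inverse mult.commute)
  qed (auto simp: g_def)
  have gj: "(\<lambda>k. g (k - j)) summable_on UNIV" "(\<Sum>\<^sub>\<infinity>k. g (k - j)) = infsum g UNIV" for j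
    using summable_on_reindex_bij_betw[of "\<lambda>k. k - j" UNIV UNIV g] infsum_reindex_bij_betw[of "\<lambda>k. k - j" UNIV UNIV g] g
    by (auto simp: bij_betwI[of _ _ _ "\<lambda>k. k + j"])
  have le: "norm (alt k) \<le> r powi (j\<^sup>2 + \<bar>j\<bar>) * g (k - j)"
    if "(0 \<le> j \<and> j \<le> k) \<or> (k < j \<and> j \<le> 0)" for j k
  proof -
    have "j\<^sup>2 + \<bar>j\<bar> + (\<bar>k - j\<bar> - 1) \<le> k\<^sup>2 + k"
      using that
    proof
      assume *: "0 \<le> j \<and> j \<le> k"
      hence "j * j \<le> k * k" by (intro mult_mono) auto
      thus ?thesis using * by (simp add: power2_eq_square)
    next
      assume *: "k < j \<and> j \<le> 0"
      \<comment> \<open>The product is \<open>(k + 1)^2 - j^2\<close>, and it is nonnegative because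
        \<open>-1 - k >= -j >= 0\<close>.\<close>
      hence "(-1 - k - (-j)) * (- 1 - k + (-j)) \<ge> 0" by (intro mult_nonneg_nonneg) auto
      moreover have "(-1 - k - (-j)) * (- 1 - k + (-j)) = k\<^sup>2 + 2 * k + 1 - j\<^sup>2"
        by (simp add: power2_eq_square algebra_simps)
      ultimately have "j\<^sup>2 \<le> k\<^sup>2 + 2 * k + 1" by linarith
      thus ?thesis using * by linarith
    qed
    hence "r powi (k\<^sup>2 + k) \<le> r powi (j\<^sup>2 + \<bar>j\<bar> + (\<bar>k - j\<bar> - 1))"
      using r by (intro power_int_decreasing) auto
    also have "\<dots> = r powi (j\<^sup>2 + \<bar>j\<bar>) * g (k - j)"
      using r unfolding g_def by (intro power_int_add) auto
    finally show ?thesis by (simp add: norm_alt r_def)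
  qed
  have tail: "norm (infsum alt A) \<le> infsum g UNIV * norm q powi (j\<^sup>2 + \<bar>j\<bar>)"
    if "\<And>k. k \<in> A \<Longrightarrow> (0 \<le> j \<and> j \<le> k) \<or> (k < j \<and> j \<le> 0)" for A j
  proof -
    have 1: "(\<lambda>k. r powi (j\<^sup>2 + \<bar>j\<bar>) * g (k - j)) summable_on UNIV"
      by (intro summable_on_cmult_right gj)
    have "norm (infsum alt A) \<le> (\<Sum>\<^sub>\<infinity>k\<in>A. r powi (j\<^sup>2 + \<bar>j\<bar>) * g (k - j))"
      using le that by (intro norm_infsum_le[OF has_sum_infsum has_sum_infsum] summable_alt
        summable_on_subset_banach[OF 1]) auto
    also have "\<dots> \<le> (\<Sum>\<^sub>\<infinity>k. r powi (j\<^sup>2 + \<bar>j\<bar>) * g (k - j))"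
      using r by (intro infsum_mono_neutral summable_on_subset_banach[OF 1] 1) (auto simp: g_def)
    also have "\<dots> = infsum g UNIV * norm q powi (j\<^sup>2 + \<bar>j\<bar>)"
      unfolding infsum_cmult_right' gj by (simp add: r_def)
    finally show ?thesis .
  qed
  have "norm (alt_sum j) \<le> infsum g UNIV * norm q powi (j\<^sup>2 + \<bar>j\<bar>)" for j
  proof (cases "j \<ge> 0")
    case True
    thus ?thesis unfolding alt_sum_eq norm_minus_cancel by (intro tail) auto
  next
    case False
    thus ?thesis unfolding alt_sum_def by (intro tail) auto
  qed
  thus ?thesis by (rule that)
qed

lemma abs_summable_Quot:
  assumes "Y \<noteq> 0"
  shows "(\<lambda>j. norm ((- Y) powi (j - 1) * alt_sum j)) summable_on UNIV"
proof -
  obtain B where B: "\<And>j. norm (alt_sum j) \<le> B * norm q powi (j\<^sup>2 + \<bar>j\<bar>)" using norm_alt_sum_le by blast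
  have "norm ((- Y) powi (j - 1) * alt_sum j) \<le> (B / norm Y) * norm q powi (j\<^sup>2 + \<bar>j\<bar>) * norm Y powi j" for j
  proof -
    have "norm ((- Y) powi (j - 1) * alt_sum j) \<le> norm Y powi (j - 1) * (B * norm q powi (j\<^sup>2 + \<bar>j\<bar>))"
      unfolding norm_mult norm_power_int norm_minus_cancel by (intro mult_left_mono B) auto
    also have "norm Y powi (j - 1) = norm Y powi j / norm Y"
      using assms by (simp add: power_int_diff)
    finally show ?thesis by (simp add: mult_ac)
  qed
  thus ?thesis
    by (rule abs_summable_on_powi_quadratic[OF norm_q, where y = "norm Y" and d = 0, rotated 2]) (use assms in auto)
qed

text \<open>After an index shift in one copy of \<open>Quot\<close>, consecutive
  \<open>alt_sum\<close> values are subtracted and \<open>alt\<close> remains.\<close>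

lemma Theta_factor:
  assumes "Y \<noteq> 0"
  shows "(1 + Y) * Quot Y = Theta Y"
proof -
  have sm: "(\<lambda>j. (- Y) powi (j - 1) * alt_sum j) summable_on UNIV"
    by (rule abs_summable_summable[OF abs_summable_Quot[OF assms]])
  have bij: "bij_betw (\<lambda>j. j + 1) UNIV (UNIV :: int set)"
    by (rule bij_betwI[of _ _ _ "\<lambda>j. j - 1"]) auto
  have sm': "(\<lambda>j. (- Y) powi j * alt_sum (j + 1)) summable_on UNIV"
    using summable_on_reindex_bij_betw[OF bij, of "\<lambda>j. (- Y) powi (j - 1) * alt_sum j"] sm by simp
  have Quot': "Quot Y = (\<Sum>\<^sub>\<infinity>j. (- Y) powi j * alt_sum (j + 1))"
    using infsum_reindex_bij_betw[OF bij, of "\<lambda>j. (- Y) powi (j - 1) * alt_sum j"] by (simp add: Quot_def)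
  have YE: "Y * Quot Y = (\<Sum>\<^sub>\<infinity>j. - ((- Y) powi j * alt_sum j))"
    unfolding Quot_def infsum_cmult_right'[symmetric]
    using assms by (intro infsum_cong) (simp add: power_int_diff)
  have "(\<lambda>j. Y * ((- Y) powi (j - 1) * alt_sum j)) summable_on UNIV"
    by (intro summable_on_cmult_right sm)
  hence sm'': "(\<lambda>j. - ((- Y) powi j * alt_sum j)) summable_on UNIV"
    by (rule summable_on_cong[THEN iffD1, rotated]) (use assms in \<open>simp add: power_int_diff\<close>)
  have "(1 + Y) * Quot Y = (\<Sum>\<^sub>\<infinity>j. (- Y) powi j * alt_sum (j + 1) + - ((- Y) powi j * alt_sum j))"
    by (simp only: ring_distribs mult_1_left YE) (simp only: Quot' infsum_add[OF sm' sm''])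
  also have "\<dots> = Theta Y"
    unfolding Theta_def
  proof (rule infsum_cong)
    fix k :: int
    have "(- Y) powi k = (-1) powi k * Y powi k"
      by (metis mult_minus1 power_int_mult_distrib)
    thus "(- Y) powi k * alt_sum (k + 1) + - ((- Y) powi k * alt_sum k) = q powi (k\<^sup>2 + k) * Y powi k"
      unfolding alt_sum_Suc alt_def by (simp add: algebra_simps)
  qed
  finally show ?thesis .
qed

text \<open>Summation by parts. Since \<open>Theta Y = (1 + Y) * Quot Y\<close>, the value is the
  derivative of \<open>Theta\<close> at -1.\<close>

lemma Quot_minus_1: "Quot (-1) = - (\<Sum>\<^sub>\<infinity>k. of_int k * alt k)"
proof -
  obtain B where B: "\<And>j. norm (alt_sum j) \<le> B * norm q powi (j\<^sup>2 + \<bar>j\<bar>)" using norm_alt_sum_le by blast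
  have sm: "alt_sum summable_on UNIV"
    using abs_summable_summable[OF abs_summable_Quot[of "-1"]] by simp
  have bij: "bij_betw (\<lambda>j. j + 1) UNIV (UNIV :: int set)"
    by (rule bij_betwI[of _ _ _ "\<lambda>j. j - 1"]) auto
  have "(\<lambda>j. norm (of_int j * alt_sum j)) summable_on UNIV"
  proof (rule abs_summable_on_powi_quadratic_exp[OF norm_q, where d = 0 and B = B and b = 1])
    fix j :: int
    have "norm (of_int j * alt_sum j) \<le> exp \<bar>real_of_int j\<bar> * (B * norm q powi (j\<^sup>2 + \<bar>j\<bar>))"
    proof -
      have "norm (of_int j :: complex) \<le> exp \<bar>real_of_int j\<bar>"
        using exp_ge_add_one_self[of "\<bar>real_of_int j\<bar>"] unfolding norm_of_int by linarith
      thus ?thesis unfolding norm_mult using B[of j] by (intro mult_mono) auto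
    qed
    thus "norm (of_int j * alt_sum j) \<le> B * norm q powi (j\<^sup>2 + \<bar>j\<bar>) * exp (1 * \<bar>real_of_int j\<bar>)"
      by (simp add: mult_ac)
  qed auto
  hence js: "(\<lambda>j. of_int j * alt_sum j) summable_on UNIV"
    by (rule abs_summable_summable)
  have js': "(\<lambda>j. of_int (j + 1) * alt_sum (j + 1)) summable_on UNIV"
    using summable_on_reindex_bij_betw[OF bij, of "\<lambda>j. of_int j * alt_sum j"] js by simp
  have alt_sum': "(\<lambda>j. alt_sum (j + 1)) summable_on UNIV"
    using summable_on_reindex_bij_betw[OF bij, of alt_sum] sm by simp
  have "(\<Sum>\<^sub>\<infinity>j. of_int (j + 1) * alt_sum (j + 1)) = (\<Sum>\<^sub>\<infinity>j. of_int j * alt_sum j)"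
    using infsum_reindex_bij_betw[OF bij, of "\<lambda>j. of_int j * alt_sum j"] by simp
  \<comment> \<open>The bracket is a difference of consecutive terms of a summable family, so its
    sum is zero.\<close>
  moreover have "of_int j * alt j = (of_int (j + 1) * alt_sum (j + 1) + - (of_int j * alt_sum j)) + - alt_sum (j + 1)" for j
    unfolding alt_sum_Suc by (simp add: algebra_simps)
  ultimately have "(\<Sum>\<^sub>\<infinity>k. of_int k * alt k) = - (\<Sum>\<^sub>\<infinity>j. alt_sum (j + 1))"
    by (simp only: infsum_add summable_on_add summable_on_uminus infsum_uminus js js' alt_sum' right_minus add_0_left)
  also have "(\<Sum>\<^sub>\<infinity>j. alt_sum (j + 1)) = Quot (-1)"
    using infsum_reindex_bij_betw[OF bij, of alt_sum] by (simp add: Quot_def)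
  finally show ?thesis by simp
qed

text \<open>Quasi-periodicity, from
  \<open>(k + l)^2 + (k + l) = (l^2 + l) + (k^2 + k) + 2 * l * k\<close>. It carries the divisor
  \<open>1 + Y\<close> over to every \<open>1 + Y * q^(2 l)\<close>.\<close>

lemma Theta_shift:
  assumes "Y \<noteq> 0"
  shows "q powi (l\<^sup>2 + l) * Y powi l * Theta (Y * q powi (2 * l)) = Theta Y"
  unfolding Theta_def infsum_cmult_right'[symmetric]
proof (rule infsum_reindex_bij_witness[of _ "\<lambda>k. k - l" "\<lambda>k. k + l"])
  fix k :: int
  have e: "(k + l)\<^sup>2 + (k + l) = (l\<^sup>2 + l) + ((k\<^sup>2 + k) + 2 * l * k)"
    by (simp add: power2_eq_square algebra_simps)
  show "q powi ((k + l)\<^sup>2 + (k + l)) * Y powi (k + l)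
      = q powi (l\<^sup>2 + l) * Y powi l * (q powi (k\<^sup>2 + k) * (Y * q powi (2 * l)) powi k)"
    unfolding e using assms q_nz
    by (simp add: power_int_add power_int_mult_distrib power_int_mult[symmetric])
qed auto

text \<open>This is \<open>Theta Y * Y\<close> times the series of
  \<open>z^l q^l / (1 + Y q^(2 l))\<close>, with each quotient of \<open>Theta\<close> replaced by
  its Laurent series, so that the poles in \<open>Y\<close> disappear.\<close>

definition Kron :: "complex \<Rightarrow> complex \<Rightarrow> complex" where
  "Kron z Y = (\<Sum>\<^sub>\<infinity>l. z powi l * q powi (l\<^sup>2 + 2 * l) * Y powi (l + 1) * Quot (Y * q powi (2 * l)))"

text \<open>Expanding \<open>Quot\<close> produces the exponent
  \<open>l^2 + 2 l + 2 l (j - 1) = (l + j)^2 - j^2\<close>. In the variables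
  \<open>m = l + j\<close> and \<open>j\<close> the double series splits, and its second factor is
  independent of \<open>Y\<close>.\<close>

lemma Kron_eq_product:
  assumes z: "norm z = 1" and Y: "Y \<noteq> 0"
  shows "Kron z Y = (\<Sum>\<^sub>\<infinity>m. q powi (m\<^sup>2) * z powi m * Y powi m)
     * (\<Sum>\<^sub>\<infinity>j. z powi (- j) * q powi (- (j\<^sup>2)) * (-1) powi (j - 1) * alt_sum j)"
proof -
  define u where "u m = q powi (m\<^sup>2) * z powi m * Y powi m" for m
  define v where "v j = z powi (- j) * q powi (- (j\<^sup>2)) * (-1) powi (j - 1) * alt_sum j" for j
  have z0: "z \<noteq> 0" using z by auto
  have u: "(\<lambda>m. norm (u m)) summable_on UNIV"
    by (rule abs_summable_on_powi_quadratic[OF norm_q, where y = "norm Y" and d = 0 and B = 1 and e = "\<lambda>m. m\<^sup>2"])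
      (use Y in \<open>auto simp: u_def norm_mult norm_power_int z\<close>)
  obtain B where B: "\<And>j. norm (alt_sum j) \<le> B * norm q powi (j\<^sup>2 + \<bar>j\<bar>)" using norm_alt_sum_le by blast
  have v: "(\<lambda>j. norm (v j)) summable_on UNIV"
  proof (rule Infinite_Sum.abs_summable_on_comparison_test')
    show "(\<lambda>j::int. B * norm q powi \<bar>j\<bar>) summable_on UNIV"
    proof (rule summable_on_cmult_right, rule summable_on_int_if_even)
      show "(\<lambda>n. norm q powi \<bar>int n\<bar>) summable_on UNIV"
        using q_less_1 by (simp, intro summable_nonneg_imp_summable_on summable_geometric) auto
    qed auto
    \<comment> \<open>The factor \<open>q^(-j^2)\<close> cancels the Gaussian decay of
      \<open>alt_sum\<close>; the geometric factor \<open>|q|^|j|\<close> is all that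
      remains.\<close>
    show "norm (v j) \<le> B * norm q powi \<bar>j\<bar>" for j
    proof -
      have "norm (v j) = norm q powi (- (j\<^sup>2)) * norm (alt_sum j)"
        by (simp add: v_def norm_mult norm_power_int z)
      also have "\<dots> \<le> norm q powi (- (j\<^sup>2)) * (B * norm q powi (j\<^sup>2 + \<bar>j\<bar>))"
        by (intro mult_left_mono B) auto
      also have "\<dots> = B * norm q powi \<bar>j\<bar>"
        using q_nz by (simp add: power_int_add power_int_minus)
      finally show ?thesis .
    qed
  qed
  have bij: "bij_betw (\<lambda>(l, j). (l + j, j)) UNIV (UNIV :: (int \<times> int) set)"
    by (rule bij_betwI[of _ _ _ "\<lambda>(m, j). (m - j, j)"]) auto
  have uv: "(\<lambda>(m, j). u m * v j) summable_on UNIV \<times> UNIV"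
    by (rule summable_on_mult_Times[OF u v])
  have term_eq: "z powi l * q powi (l\<^sup>2 + 2 * l) * Y powi (l + 1) * ((- (Y * q powi (2 * l))) powi (j - 1) * alt_sum j)
      = u (l + j) * v j" for l j
  proof -
    have "q powi (l\<^sup>2 + 2 * l) * (q powi (2 * l)) powi (j - 1) = q powi (l\<^sup>2 + 2 * l + 2 * l * (j - 1))"
      using q_nz power_int_add[of q "l\<^sup>2 + 2 * l" "2 * l * (j - 1)"] power_int_mult[of q "2 * l" "j - 1"] by simp
    also have "l\<^sup>2 + 2 * l + 2 * l * (j - 1) = (l + j)\<^sup>2 + - (j\<^sup>2)"
      by (simp add: power2_eq_square algebra_simps)
    also have "q powi \<dots> = q powi ((l + j)\<^sup>2) * q powi (- (j\<^sup>2))"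
      using q_nz power_int_add[of q "(l + j)\<^sup>2" "- (j\<^sup>2)"] by simp
    finally have 1: "q powi (l\<^sup>2 + 2 * l) * (q powi (2 * l)) powi (j - 1) = q powi ((l + j)\<^sup>2) * q powi (- (j\<^sup>2))" .
    have 2: "Y powi (l + 1) * Y powi (j - 1) = Y powi (l + j)"
      using Y by (simp flip: power_int_add)
    have 3: "z powi l = z powi (l + j) * z powi (- j)"
      using z0 by (simp flip: power_int_add)
    have 4: "(- (Y * q powi (2 * l))) powi (j - 1) = (-1) powi (j - 1) * (Y powi (j - 1) * (q powi (2 * l)) powi (j - 1))"
      by (metis mult_minus1 power_int_mult_distrib)
    have "z powi l * q powi (l\<^sup>2 + 2 * l) * Y powi (l + 1) * ((- (Y * q powi (2 * l))) powi (j - 1) * alt_sum j)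
      = z powi l * (q powi (l\<^sup>2 + 2 * l) * (q powi (2 * l)) powi (j - 1)) * (Y powi (l + 1) * Y powi (j - 1)) * (-1) powi (j - 1) * alt_sum j"
      unfolding 4 by (simp only: mult_ac)
    also have "\<dots> = u (l + j) * v j"
      unfolding 1 2 3 u_def v_def by (simp only: mult_ac)
    finally show ?thesis .
  qed
  have "Kron z Y = (\<Sum>\<^sub>\<infinity>l. \<Sum>\<^sub>\<infinity>j. u (l + j) * v j)"
    unfolding Kron_def Quot_def infsum_cmult_right'[symmetric] term_eq ..
  also have "\<dots> = (\<Sum>\<^sub>\<infinity>(l, j)\<in>UNIV \<times> UNIV. u (l + j) * v j)"
    using uv summable_on_reindex_bij_betw[OF bij, of "\<lambda>(m, j). u m * v j"]
    by (intro infsum_Sigma'_banach) (simp add: case_prod_unfold)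
  also have "\<dots> = (\<Sum>\<^sub>\<infinity>(m, j)\<in>UNIV \<times> UNIV. u m * v j)"
    using infsum_reindex_bij_betw[OF bij, of "\<lambda>(m, j). u m * v j"] by (simp add: case_prod_unfold)
  also have "\<dots> = (\<Sum>\<^sub>\<infinity>m. \<Sum>\<^sub>\<infinity>j. u m * v j)"
    by (rule infsum_Sigma'_banach[OF uv, symmetric])
  also have "\<dots> = infsum u UNIV * infsum v UNIV"
    by (simp add: infsum_cmult_right' infsum_cmult_left')
  finally show ?thesis unfolding u_def v_def .
qed

text \<open>By quasi-periodicity \<open>Theta\<close> vanishes at every \<open>- q^(2 l)\<close>.
  For \<open>l\<close> nonzero the factor \<open>1 - q^(2 l)\<close> does not, so
  \<open>Quot\<close> does, and only the term \<open>l = 0\<close> is left.\<close>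

lemma Kron_minus_1: "Kron z (-1) = (\<Sum>\<^sub>\<infinity>k. of_int k * alt k)"
proof -
  have T0: "Theta (-1) = 0"
    using infsum_alt by (simp add: Theta_def alt_def mult.commute)
  have E0: "q powi (l\<^sup>2 + 2 * l) * Quot ((-1) * q powi (2 * l)) = 0" if "l \<noteq> 0" for l
  proof -
    have "Theta ((-1) * q powi (2 * l)) = 0"
      using Theta_shift[of "-1" l] T0 q_nz by simp
    hence "(1 + (-1) * q powi (2 * l)) * Quot ((-1) * q powi (2 * l)) = 0"
      using Theta_factor[of "(-1) * q powi (2 * l)"] q_nz by simp
    moreover have "1 + (-1) * q powi (2 * l) \<noteq> 0"
    proof
      assume "1 + (-1) * q powi (2 * l) = 0"
      hence "norm (q powi (2 * l)) = 1" by (simp add: algebra_simps)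
      hence "norm q powi (2 * l) = 1" by (simp add: norm_power_int)
      thus False using that q_nz q_less_1 
        power_int_strict_decreasing[of 0 "2 * l" "norm q"] power_int_strict_decreasing[of "2 * l" 0 "norm q"]
        by (cases "l > 0") auto
    qed
    ultimately show ?thesis by simp
  qed
  have "Kron z (-1) = (\<Sum>\<^sub>\<infinity>l\<in>{0}. z powi l * q powi (l\<^sup>2 + 2 * l) * (-1) powi (l + 1) * Quot ((-1) * q powi (2 * l)))"
    unfolding Kron_def using E0 by (intro infsum_cong_neutral) auto
  thus ?thesis by (simp add: Quot_minus_1)
qed

text \<open>Comparing the product formula at \<open>Y\<close> and at -1 eliminates the factor
  depending on \<open>z\<close> alone. Cross-multiplication avoids dividing by the theta series at
  \<open>Y = -1\<close>.\<close>

lemma Kron_mult: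
  assumes "norm z = 1" "Y \<noteq> 0"
  shows "Kron z Y * (\<Sum>\<^sub>\<infinity>m. (-1) powi m * q powi (m\<^sup>2) * z powi m)
    = (\<Sum>\<^sub>\<infinity>k. of_int k * alt k) * (\<Sum>\<^sub>\<infinity>m. q powi (m\<^sup>2) * z powi m * Y powi m)"
  using Kron_eq_product[OF assms] Kron_eq_product[OF assms(1), of "-1"]
  by (simp add: Kron_minus_1 mult_ac)

lemma Kron_eq:
  assumes Y: "Y \<noteq> 0" and ne: "\<And>l. 1 + Y * q powi (2 * l) \<noteq> 0"
  shows "Kron z Y = Theta Y * Y * (\<Sum>\<^sub>\<infinity>l. z powi l * q powi l / (1 + Y * q powi (2 * l)))"
  unfolding Kron_def infsum_cmult_right'[symmetric]
proof (rule infsum_cong)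
  fix l :: int
  have e: "q powi (l\<^sup>2 + 2 * l) = q powi (l\<^sup>2 + l) * q powi l"
    using q_nz by (simp add: ac_simps flip: power_int_add)
  have "Quot (Y * q powi (2 * l)) = Theta (Y * q powi (2 * l)) / (1 + Y * q powi (2 * l))"
    using Theta_factor[of "Y * q powi (2 * l)"] ne[of l] Y q_nz by (simp add: field_simps)
  moreover have "Y powi (l + 1) = Y * Y powi l"
    using Y by (simp add: power_int_add)
  ultimately show "z powi l * q powi (l\<^sup>2 + 2 * l) * Y powi (l + 1) * Quot (Y * q powi (2 * l))
    = Theta Y * Y * (z powi l * q powi l / (1 + Y * q powi (2 * l)))"
    unfolding Theta_shift[OF Y, of l, symmetric] e by simp
qed

end

subsection \<open>The Zak transform of the hyperbolic secant\<close>

lemma exp_of_int_mult: "exp (of_int n * x) = exp x powi n" for x :: "'a :: {real_normed_field, banach}"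
  by (simp add: exp_power_int)

lemma of_real_powr_square:
  "q > 0 \<Longrightarrow> complex_of_real (q powr (of_int n)\<^sup>2) = of_real q powi n\<^sup>2"
  using powr_real_of_int'[of q "n\<^sup>2"] by (simp add: of_real_power_int)

lemma of_real_powr_half_square:
  assumes "q > 0"
  shows "complex_of_real (q powr (of_int n + 1/2)\<^sup>2) = of_real (q powr (1/4)) * of_real q powi (n\<^sup>2 + n)"
proof -
  have "(of_int n + 1/2)\<^sup>2 = 1/4 + real_of_int (n\<^sup>2 + n)"
    by (simp add: power2_eq_square algebra_simps)
  hence "q powr (of_int n + 1/2)\<^sup>2 = q powr (1/4) * q powi (n\<^sup>2 + n)"
  proof -
    have "q powr real_of_int (n\<^sup>2 + n) = q powi (n\<^sup>2 + n)"
      using assms by (intro powr_real_of_int') auto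
    thus ?thesis by (simp only: \<open>(of_int n + 1/2)\<^sup>2 = 1/4 + real_of_int (n\<^sup>2 + n)\<close> powr_add)
  qed
  thus ?thesis by (simp add: of_real_power_int)
qed

lemma nome_of_real: "0 < q \<Longrightarrow> q < 1 \<Longrightarrow> nome (complex_of_real q)"
  by unfold_locales auto

lemma (in nome) summable_of_int_mult_alt: "(\<lambda>k. of_int k * alt k) summable_on UNIV"
proof (rule abs_summable_summable, rule abs_summable_on_powi_quadratic_exp[OF norm_q, where d = 1 and B = 1 and b = 1])
  fix j :: int
  have "norm (of_int j :: complex) \<le> exp \<bar>real_of_int j\<bar>"
    using exp_ge_add_one_self[of "\<bar>real_of_int j\<bar>"] unfolding norm_of_int by linarith
  hence "norm (of_int j * alt j) \<le> exp \<bar>real_of_int j\<bar> * norm q powi (j\<^sup>2 + j)"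
    unfolding norm_mult norm_alt by (rule mult_right_mono) auto
  thus "norm (of_int j * alt j) \<le> 1 * norm q powi (j\<^sup>2 + j) * exp (1 * \<bar>real_of_int j\<bar>)"
    by (simp add: mult.commute)
qed auto

text \<open>Termwise differentiation, justified by uniform convergence on the closed unit disc
  around 0.\<close>

lemma theta1'_0:
  assumes q: "0 < q" "q < 1"
  shows "theta1' 0 q = 2 * of_real (q powr (1/4)) * (\<Sum>\<^sub>\<infinity>k. of_int k * nome.alt (of_real q) k)"
proof -
  interpret nome "complex_of_real q" using q by (rule nome_of_real)
  define c where "c n = (-1) powi n * complex_of_real (q powr (of_int n + 1/2)\<^sup>2)" for n
  define f where "f n w = c n * exp ((2 * of_int n + 1) * \<i> * w)" for n w
  have c: "c n = of_real (q powr (1/4)) * alt n" for n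
    unfolding c_def alt_def of_real_powr_half_square[OF q(1)] by (simp add: mult_ac)
  \<comment> \<open>On that disc \<open>exp ((2 n + 1) i w)\<close> has norm at most
    \<open>exp (2 |n| + 1)\<close>.\<close>
  define M where "M n = (q powr (1/4) * exp 1) * q powi (n\<^sup>2 + n) * exp (2 * \<bar>real_of_int n\<bar>)" for n
  have "(\<lambda>n. norm (M n)) summable_on UNIV"
    by (rule abs_summable_on_powi_quadratic_exp[OF q, where d = 1 and b = 2 and e = "\<lambda>n. n\<^sup>2 + n"])
      (use q in \<open>auto simp: M_def abs_mult\<close>)
  hence M: "M summable_on UNIV" by (rule abs_summable_summable)
  have bound: "norm (f n w) \<le> M n" if "w \<in> cball 0 1" for n w
  proof -
    have "norm (exp ((2 * of_int n + 1) * \<i> * w)) \<le> exp (norm ((2 * of_int n + 1) * \<i> * w))"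
      by (rule norm_exp)
    also have "norm ((2 * of_int n + 1) * \<i> * w) \<le> (2 * \<bar>real_of_int n\<bar> + 1) * 1"
      unfolding norm_mult
    proof (intro mult_mono)
      show "norm (2 * complex_of_int n + 1) * norm \<i> \<le> 2 * \<bar>real_of_int n\<bar> + 1"
        using norm_triangle_ineq[of "2 * complex_of_int n" 1] by (simp add: norm_mult)
    qed (use that in auto)
    finally have "norm (exp ((2 * of_int n + 1) * \<i> * w)) \<le> exp 1 * exp (2 * \<bar>real_of_int n\<bar>)"
      by (simp add: exp_add[symmetric] add.commute)
    hence "norm (f n w) \<le> (q powr (1/4) * q powi (n\<^sup>2 + n)) * (exp 1 * exp (2 * \<bar>real_of_int n\<bar>))"
      unfolding f_def c norm_mult norm_alt using q by (intro mult_mono) auto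
    thus ?thesis by (simp add: M_def mult_ac)
  qed
  have ulim: "uniform_limit (cball 0 1) (\<lambda>X w. \<Sum>n\<in>X. f n w) (\<lambda>w. \<Sum>\<^sub>\<infinity>n. f n w) (finite_subsets_at_top UNIV)"
    by (rule Weierstrass_m_test_general[OF bound M])
  obtain g' where g': "\<And>w. w \<in> ball 0 1 \<Longrightarrow>
      ((\<lambda>w. \<Sum>\<^sub>\<infinity>n. f n w) has_field_derivative g' w) (at w) \<and>
      ((\<lambda>X. \<Sum>n\<in>X. f n w * ((2 * of_int n + 1) * \<i>)) \<longlongrightarrow> g' w) (finite_subsets_at_top UNIV)"
  proof (rule has_complex_derivative_uniform_limit[OF _ ulim, of "\<lambda>X w. \<Sum>n\<in>X. f n w * ((2 * of_int n + 1) * \<i>)"])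
    show "\<forall>\<^sub>F X in finite_subsets_at_top UNIV. continuous_on (cball 0 1) (\<lambda>w. \<Sum>n\<in>X. f n w) \<and>
      (\<forall>w\<in>ball 0 1. ((\<lambda>w. \<Sum>n\<in>X. f n w) has_field_derivative (\<Sum>n\<in>X. f n w * ((2 * of_int n + 1) * \<i>))) (at w))"
      unfolding f_def
      by (intro always_eventually allI conjI ballI continuous_intros DERIV_sum)
        (auto intro!: derivative_eq_intros)
  qed auto
  have "((\<lambda>n. f n 0 * ((2 * of_int n + 1) * \<i>)) has_sum g' 0) UNIV"
    using g'[of 0] by (simp add: has_sum_def)
  hence "g' 0 = (\<Sum>\<^sub>\<infinity>n. f n 0 * ((2 * of_int n + 1) * \<i>))"
    by (simp add: infsumI)
  also have "\<dots> = (\<Sum>\<^sub>\<infinity>n. (\<i> * of_real (q powr (1/4))) * (2 * (of_int n * alt n) + alt n))"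
    by (simp add: f_def c algebra_simps)
  \<comment> \<open>The summand 1 in \<open>2 n + 1\<close> contributes the full sum of
    \<open>alt\<close>, which is zero.\<close>
  also have "\<dots> = (\<i> * of_real (q powr (1/4))) * (2 * (\<Sum>\<^sub>\<infinity>n. of_int n * alt n))"
    by (simp only: infsum_cmult_right' infsum_add[OF summable_on_cmult_right[OF summable_of_int_mult_alt] summable_alt] infsum_alt add_0_right)
  finally have g0: "g' 0 = (\<i> * of_real (q powr (1/4))) * (2 * (\<Sum>\<^sub>\<infinity>n. of_int n * alt n))" .
  have "(\<lambda>w. theta1 w q) = (\<lambda>w. 1 / \<i> * (\<Sum>\<^sub>\<infinity>n. f n w))"
    by (simp add: theta1_def f_def c_def)
  moreover have "((\<lambda>w. 1 / \<i> * (\<Sum>\<^sub>\<infinity>n. f n w)) has_field_derivative 1 / \<i> * g' 0) (at 0)"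
    using g'[of 0] by (intro DERIV_cmult) auto
  ultimately have "theta1' 0 q = 1 / \<i> * g' 0"
    unfolding theta1'_def by (simp add: DERIV_imp_deriv)
  thus ?thesis unfolding g0 by (simp add: mult_ac)
qed

text \<open>Writing \<open>(-1)^n\<close> as \<open>exp (i pi n)\<close> shifts \<open>t\<close> by
  one half, and the imaginary parts of the terms \<open>n\<close> and \<open>- n\<close>
  cancel.\<close>

lemma theta4_eq_cos_sum:
  assumes "c > 0"
  shows "theta4 (of_real (pi * t)) (exp (- pi / c)) = of_real (cos_sum c (t + 1/2))"
proof -
  define b where "b n = exp (- pi * (real_of_int n)\<^sup>2 / c)" for n
  define g where "g n = complex_of_real (b n) * exp (\<i> * of_real (2 * pi * of_int n * (t + 1/2)))" for n
  have b: "b summable_on UNIV"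
    unfolding b_def using summable_on_exp_square[OF assms] .
  have "(\<lambda>n. norm (g n)) summable_on UNIV"
    using b unfolding b_def by (simp add: g_def b_def norm_mult)
  hence g: "g summable_on UNIV" by (rule abs_summable_summable)
  have "(\<Sum>\<^sub>\<infinity>n. Im (g n)) = (\<Sum>\<^sub>\<infinity>n. - Im (g n))"
    by (rule infsum_reindex_bij_witness[of _ uminus uminus]) (auto simp: g_def b_def Im_exp)
  hence "Im (infsum g UNIV) = 0"
    using infsum_Im[OF g] by (simp add: infsum_uminus)
  moreover have "Re (infsum g UNIV) = cos_sum c (t + 1/2)"
    using infsum_Re[OF g] by (simp add: cos_sum_def g_def b_def Re_exp)
  ultimately have "infsum g UNIV = of_real (cos_sum c (t + 1/2))"
    by (simp add: complex_eq_iff)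
  moreover have "(-1) powi n * of_real (exp (- pi / c) powr (of_int n)\<^sup>2) * exp (2 * of_int n * \<i> * of_real (pi * t)) = g n" for n
  proof -
    have 1: "(-1) powi n = exp (of_int n * (\<i> * of_real pi))"
      unfolding exp_of_int_mult by simp
    have "(-1) powi n * exp (2 * of_int n * \<i> * of_real (pi * t)) = exp (\<i> * of_real (2 * pi * of_int n * (t + 1/2)))"
      unfolding 1 exp_add[symmetric] by (rule arg_cong[of _ _ exp]) (simp add: algebra_simps)
    moreover have "exp (- pi / c) powr (of_int n)\<^sup>2 = b n"
      by (simp add: powr_def b_def mult.commute)
    ultimately show ?thesis
      unfolding g_def by (simp only: mult.assoc mult.left_commute[of "(-1) powi n"])
  qed
  ultimately show ?thesis by (simp add: theta4_def)
qed

text \<open>Poisson summation turns the alternating series into \<open>sqrt c\<close> times a sum of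
  positive Gaussians.\<close>

lemma theta4_of_real_nonzero: "c > 0 \<Longrightarrow> theta4 (of_real (pi * t)) (exp (- pi / c)) \<noteq> 0"
  using gauss_sum_pos[of c "t + 1/2"]
  by (simp only: theta4_eq_cos_sum gauss_sum_eq_cos_sum[symmetric] of_real_eq_0_iff) simp

lemma gauss_sum_half_eq_Theta:
  assumes "c > 0"
  defines "q \<equiv> exp (- pi * c)"
  shows "of_real (gauss_sum c (t + 1/2))
    = of_real (exp (- pi * c * t\<^sup>2) * q powr (1/4) * exp (pi * c * t)) * nome.Theta (of_real q) (of_real (exp (2 * pi * c * t)))"
proof -
  interpret nome "complex_of_real q"
    using assms by (intro nome_of_real) (auto simp: q_def)
  have "of_real (gauss_sum c (t + 1/2)) = (\<Sum>\<^sub>\<infinity>k::int. complex_of_real (exp (- pi * c * (t + 1/2 - of_int k)\<^sup>2)))"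
    by (rule infsumI[OF has_sum_of_real[OF has_sum_gauss_sum[OF assms(1)]], symmetric])
  \<comment> \<open>Replacing \<open>k\<close> by \<open>k + 1\<close> produces
    \<open>k + 1/2\<close>, whose square \<open>k^2 + k + 1/4\<close> has the exponent of
    \<open>Theta\<close>.\<close>
  also have "\<dots> = (\<Sum>\<^sub>\<infinity>k::int. complex_of_real (exp (- pi * c * (t - (of_int k + 1/2))\<^sup>2)))"
    by (rule infsum_reindex_bij_witness[of _ "\<lambda>k. k + 1" "\<lambda>k. k - 1"]) (auto simp: algebra_simps)
  also have "\<dots> = (\<Sum>\<^sub>\<infinity>k. of_real (exp (- pi * c * t\<^sup>2) * q powr (1/4) * exp (pi * c * t))
      * (of_real q powi (k\<^sup>2 + k) * of_real (exp (2 * pi * c * t)) powi k))"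
  proof (rule infsum_cong)
    fix k :: int
    have 1: "- pi * c * (t - (of_int k + 1/2))\<^sup>2
      = - pi * c * t\<^sup>2 + (1/4) * (- pi * c) + pi * c * t + of_int (k\<^sup>2 + k) * (- pi * c) + of_int k * (2 * pi * c * t)"
      by (simp add: power2_eq_square algebra_simps)
    have "exp (- pi * c * (t - (of_int k + 1/2))\<^sup>2)
      = exp (- pi * c * t\<^sup>2) * q powr (1/4) * exp (pi * c * t) * (q powi (k\<^sup>2 + k) * exp (2 * pi * c * t) powi k)"
      unfolding 1 exp_add exp_of_int_mult by (simp add: q_def powr_def)
    thus "complex_of_real (exp (- pi * c * (t - (of_int k + 1/2))\<^sup>2))
      = of_real (exp (- pi * c * t\<^sup>2) * q powr (1/4) * exp (pi * c * t))
      * (of_real q powi (k\<^sup>2 + k) * of_real (exp (2 * pi * c * t)) powi k)"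
      by (simp only: of_real_mult of_real_power_int)
  qed
  also have "\<dots> = of_real (exp (- pi * c * t\<^sup>2) * q powr (1/4) * exp (pi * c * t)) * Theta (of_real (exp (2 * pi * c * t)))"
    unfolding Theta_def by (rule infsum_cmult_right')
  finally show ?thesis .
qed

text \<open>The imaginary shift of the argument contributes the positive real base
  \<open>exp (2 pi c t)\<close>, so this is the first factor of
  \<open>Kron_eq_product\<close>.\<close>

lemma theta3_eq:
  assumes "q > 0"
  shows "theta3 (of_real pi * (of_real \<nu> - \<i> * of_real c * of_real t)) q
    = (\<Sum>\<^sub>\<infinity>m. of_real q powi m\<^sup>2 * exp (2 * of_real pi * \<i> * of_real \<nu>) powi m * of_real (exp (2 * pi * c * t)) powi m)"
  unfolding theta3_def
proof (rule infsum_cong)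
  fix m :: int
  have "2 * of_int m * \<i> * (of_real pi * (of_real \<nu> - \<i> * of_real c * of_real t))
     = of_int m * (2 * of_real pi * \<i> * of_real \<nu>) + of_int m * (complex_of_real (2 * pi * c * t))"
    by (simp add: algebra_simps)
  thus "of_real (q powr (of_int m)\<^sup>2) * exp (2 * of_int m * \<i> * (of_real pi * (of_real \<nu> - \<i> * of_real c * of_real t)))
    = of_real q powi m\<^sup>2 * exp (2 * of_real pi * \<i> * of_real \<nu>) powi m * of_real (exp (2 * pi * c * t)) powi m"
    by (simp only: exp_add exp_of_int_mult of_real_powr_square[OF assms] exp_of_real mult.assoc)
qed

lemma theta4_eq:
  assumes "q > 0"
  shows "theta4 (of_real (pi * \<nu>)) q
    = (\<Sum>\<^sub>\<infinity>m. (-1) powi m * of_real q powi m\<^sup>2 * exp (2 * of_real pi * \<i> * of_real \<nu>) powi m)"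
  unfolding theta4_def
proof (rule infsum_cong)
  fix m :: int
  have "2 * of_int m * \<i> * complex_of_real (pi * \<nu>) = of_int m * (2 * of_real pi * \<i> * of_real \<nu>)"
    by simp
  thus "(-1) powi m * of_real (q powr (of_int m)\<^sup>2) * exp (2 * of_int m * \<i> * of_real (pi * \<nu>))
    = (-1) powi m * of_real q powi m\<^sup>2 * exp (2 * of_real pi * \<i> * of_real \<nu>) powi m"
    by (simp only: exp_of_int_mult of_real_powr_square[OF assms])
qed

lemma zak_gauss_window:
  "zak (gauss_window c) t \<nu> = of_real ((2 * c) powr (1/4) * exp (- pi * c * t\<^sup>2))
     * theta3 (of_real pi * (of_real \<nu> - \<i> * of_real c * of_real t)) (exp (- pi * c))"
  unfolding zak_def gauss_window_def theta3_eq[OF exp_gt_zero] infsum_cmult_right'[symmetric]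
proof (rule infsum_cong)
  fix l :: int
  have 1: "- pi * c * (t - of_int l)\<^sup>2 = - pi * c * t\<^sup>2 + of_int (l\<^sup>2) * (- pi * c) + of_int l * (2 * pi * c * t)"
    by (simp add: power2_eq_square algebra_simps)
  have 2: "2 * of_real pi * \<i> * of_int l * of_real \<nu> = of_int l * (2 * of_real pi * \<i> * complex_of_real \<nu>)"
    by simp
  show "of_real ((2 * c) powr (1/4) * exp (- pi * c * (t - of_int l)\<^sup>2)) * exp (2 * of_real pi * \<i> * of_int l * of_real \<nu>)
    = of_real ((2 * c) powr (1/4) * exp (- pi * c * t\<^sup>2))
      * (of_real (exp (- pi * c)) powi l\<^sup>2 * exp (2 * of_real pi * \<i> * of_real \<nu>) powi l * of_real (exp (2 * pi * c * t)) powi l)"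
    unfolding 1 2 exp_add exp_of_int_mult by (simp only: of_real_mult of_real_power_int mult_ac)
qed

lemma zak_sech_window:
  "zak (sech_window c) t \<nu> = of_real ((pi * c / 2) powr (1/2) * (2 * exp (pi * c * t)))
     * (\<Sum>\<^sub>\<infinity>l. exp (2 * of_real pi * \<i> * of_real \<nu>) powi l * of_real (exp (- pi * c)) powi l
          / (1 + of_real (exp (2 * pi * c * t)) * of_real (exp (- pi * c)) powi (2 * l)))"
  unfolding zak_def sech_window_def infsum_cmult_right'[symmetric]
proof (rule infsum_cong)
  fix l :: int
  \<comment> \<open>Here \<open>q\<close> denotes the \<open>l\<close>-th power of the nome. With
    the argument of \<open>cosh\<close> exponentiated to \<open>y * q\<close>, the reciprocal
    becomes \<open>2 y q / (1 + y^2 q^2)\<close>.\<close>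
  define q y where "q = exp (- pi * c) powi l" and "y = exp (pi * c * t)"
  have pos: "q > 0" "y > 0" by (auto simp: q_def y_def)
  have 1: "exp (2 * pi * c * t) = y\<^sup>2"
    using exp_double[of "pi * c * t"] by (simp add: y_def mult.assoc)
  have q2: "exp (- pi * c) powi (2 * l) = q\<^sup>2"
    using power_int_mult[of "exp (- pi * c)" l 2] unfolding q_def by (simp only: mult.commute[of 2 l] power_int_numeral)
  have "exp (pi * c * (t - of_int l)) = y * q"
    unfolding y_def q_def exp_of_int_mult[symmetric] exp_add[symmetric] by (simp add: algebra_simps)
  hence "cosh (pi * c * (t - of_int l)) = (y * q + inverse (y * q)) / 2"
    unfolding cosh_def exp_minus by simp
  hence "1 / cosh (pi * c * (t - of_int l)) = 1 / ((y * q + inverse (y * q)) / 2)"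
    by (simp only:)
  also have "\<dots> = 2 / (y * q + inverse (y * q))" by simp
  also have "\<dots> = 2 * y * (q / (1 + y\<^sup>2 * q\<^sup>2))"
    using pos by (simp add: divide_simps power2_eq_square) (simp add: algebra_simps)
  finally have 2: "1 / cosh (pi * c * (t - of_int l)) = 2 * y * (q / (1 + y\<^sup>2 * q\<^sup>2))" .
  have 3: "2 * of_real pi * \<i> * of_int l * of_real \<nu> = of_int l * (2 * of_real pi * \<i> * complex_of_real \<nu>)"
    by simp
  show "of_real ((pi * c / 2) powr (1/2) * (1 / cosh (pi * c * (t - of_int l)))) * exp (2 * of_real pi * \<i> * of_int l * of_real \<nu>)
    = of_real ((pi * c / 2) powr (1/2) * (2 * exp (pi * c * t)))
     * (exp (2 * of_real pi * \<i> * of_real \<nu>) powi l * of_real (exp (- pi * c)) powi l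
          / (1 + of_real (exp (2 * pi * c * t)) * of_real (exp (- pi * c)) powi (2 * l)))"
    unfolding 2 3 exp_of_int_mult of_real_power_int[symmetric] 1 q2
    by (simp add: q_def y_def)
qed

text \<open>Poisson summation identifies \<open>theta4 (pi t)\<close> with a multiple of
  \<open>Theta X\<close>, so the left side is a multiple of \<open>Kron\<close> times
  \<open>theta4 (pi nu)\<close>, and \<open>Kron_mult\<close> evaluates it.\<close>

lemma zak_sech_window_mult:
  assumes "c > 0"
  shows "zak (sech_window c) t \<nu>
      * (theta4 (of_real (pi * \<nu>)) (exp (- pi * c)) * theta4 (of_real (pi * t)) (exp (- pi / c)))
    = of_real (2 powr (-1/2) * pi powr (1/2) * c) * theta1' 0 (exp (- pi * c)) * of_real (exp (- pi * c * t\<^sup>2))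
      * theta3 (of_real pi * (of_real \<nu> - \<i> * of_real c * of_real t)) (exp (- pi * c))"
proof -
  define q X where "q = exp (- pi * c)" and "X = exp (2 * pi * c * t)"
  define z where "z = exp (2 * of_real pi * \<i> * complex_of_real \<nu>)"
  have q: "0 < q" "q < 1" using assms by (auto simp: q_def)
  interpret nome "complex_of_real q" using q by (rule nome_of_real)
  define F where "F = (\<Sum>\<^sub>\<infinity>l. z powi l * of_real q powi l / (1 + of_real X * of_real q powi (2 * l)))"
  define S where "S = (\<Sum>\<^sub>\<infinity>k. of_int k * alt k)"
  define th3 th4 where "th3 = theta3 (of_real pi * (of_real \<nu> - \<i> * of_real c * of_real t)) q"
    and "th4 = theta4 (of_real (pi * \<nu>)) q"
  have X: "X > 0" by (simp add: X_def)
  \<comment> \<open>One factor \<open>exp (pi * c * t)\<close> comes from the Zak series and one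
    from \<open>theta4 (pi t)\<close>; together they supply the factor \<open>Y\<close> in
    \<open>Kron_eq\<close>.\<close>
  have XX: "complex_of_real X = of_real (exp (pi * c * t)) * of_real (exp (pi * c * t))"
    by (simp add: X_def of_real_mult[symmetric] exp_add[symmetric] del: of_real_mult)
  have z: "norm z = 1" by (simp add: z_def)
  have nz: "1 + complex_of_real X * of_real q powi (2 * l) \<noteq> 0" for l
  proof -
    have "1 + X * q powi (2 * l) > 0" using X q(1) by (intro add_pos_pos mult_pos_pos) auto
    moreover have "1 + complex_of_real X * of_real q powi (2 * l) = of_real (1 + X * q powi (2 * l))"
      by (simp add: of_real_power_int)
    ultimately show ?thesis by (simp only: of_real_eq_0_iff)
  qed
  have "Kron z (of_real X) = Theta (of_real X) * of_real X * F"
    unfolding F_def using X nz by (intro Kron_eq) auto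
  moreover have "Kron z (of_real X) * th4 = S * th3"
    unfolding S_def th3_def th4_def theta3_eq[OF q(1)] theta4_eq[OF q(1)]
    using Kron_mult[OF z, of "of_real X"] X unfolding z_def X_def by simp
  ultimately have main: "Theta (of_real X) * of_real X * F * th4 = S * th3" by simp
  have t4: "theta4 (of_real (pi * t)) (exp (- pi / c))
    = of_real (sqrt c) * (of_real (exp (- pi * c * t\<^sup>2) * q powr (1/4) * exp (pi * c * t)) * Theta (of_real X))"
    using gauss_sum_half_eq_Theta[OF assms, of t]
    unfolding theta4_eq_cos_sum[OF assms] gauss_sum_eq_cos_sum[OF assms, symmetric]
    by (simp add: q_def X_def)
  define TX where "TX = Theta (of_real X)"
  have zs: "zak (sech_window c) t \<nu> = of_real ((pi * c / 2) powr (1/2) * (2 * exp (pi * c * t))) * F"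
    unfolding zak_sech_window F_def z_def q_def X_def ..
  have const: "(pi * c / 2) powr (1/2) * sqrt c = 2 powr (-1/2) * pi powr (1/2) * c"
  proof -
    have "(pi * c / 2) powr (1/2) * c powr (1/2) = (pi powr (1/2) * c powr (1/2) / 2 powr (1/2)) * c powr (1/2)"
      using assms by (simp add: powr_mult powr_divide)
    also have "\<dots> = (1 / 2 powr (1/2)) * pi powr (1/2) * (c powr (1/2) * c powr (1/2))" by simp
    also have "c powr (1/2) * c powr (1/2) = c" using assms by (simp flip: powr_add)
    also have "1 / 2 powr (1/2) = (2 :: real) powr (-1/2)" using powr_minus_divide[of 2 "1/2 :: real"] by simp
    finally show ?thesis using assms by (simp add: powr_half_sqrt)
  qed
  have "zak (sech_window c) t \<nu> * (th4 * theta4 (of_real (pi * t)) (exp (- pi / c)))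
    = of_real ((pi * c / 2) powr (1/2) * sqrt c) * of_real (exp (- pi * c * t\<^sup>2)) * (2 * of_real (q powr (1/4)))
      * (TX * of_real X * F * th4)"
    unfolding zs t4 TX_def[symmetric] unfolding of_real_mult XX by (simp add: mult_ac)
  also have "\<dots> = of_real (2 powr (-1/2) * pi powr (1/2) * c) * (2 * of_real (q powr (1/4)) * S)
      * of_real (exp (- pi * c * t\<^sup>2)) * th3"
    unfolding main[folded TX_def] const by (simp add: mult_ac)
  also have "2 * of_real (q powr (1/4)) * S = theta1' 0 q"
    unfolding S_def theta1'_0[OF q] ..
  finally show ?thesis unfolding th3_def th4_def q_def .
qed

theorem theorem3p1:
  fixes \<gamma> :: real
  assumes "\<gamma> > 0"
  shows "\<forall>t \<nu> :: real.
    zak (sech_window \<gamma>) t \<nu>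
      = of_real (2 powr (-1/2) * pi powr (1/2) * \<gamma>) * theta1' 0 (exp (- pi * \<gamma>))
        * of_real (exp (- pi * \<gamma> * t\<^sup>2))
        * (theta3 (of_real pi * (of_real \<nu> - \<i> * of_real \<gamma> * of_real t)) (exp (- pi * \<gamma>))
           / (theta4 (of_real (pi * \<nu>)) (exp (- pi * \<gamma>))
              * theta4 (of_real (pi * t)) (exp (- pi / \<gamma>))))
    \<and> zak (sech_window \<gamma>) t \<nu>
      = of_real (pi powr (1/2) * (\<gamma> / 2) powr (3/4)) * theta1' 0 (exp (- pi * \<gamma>))
        * (zak (gauss_window \<gamma>) t \<nu>
           / (theta4 (of_real (pi * \<nu>)) (exp (- pi * \<gamma>))
              * theta4 (of_real (pi * t)) (exp (- pi / \<gamma>))))"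
proof (intro allI)
  fix t \<nu> :: real
  define D where "D = theta4 (of_real (pi * \<nu>)) (exp (- pi * \<gamma>)) * theta4 (of_real (pi * t)) (exp (- pi / \<gamma>))"
  define P where "P = theta3 (of_real pi * (of_real \<nu> - \<i> * of_real \<gamma> * of_real t)) (exp (- pi * \<gamma>))"
  \<comment> \<open>The nome \<open>exp (- pi * \<gamma>)\<close> is the case
    \<open>c = inverse \<gamma>\<close> of the nonvanishing result, and
    \<open>exp (- pi / \<gamma>)\<close> is the case \<open>c = \<gamma>\<close>.\<close>
  have "D \<noteq> 0"
    using theta4_of_real_nonzero[of \<gamma> t] theta4_of_real_nonzero[of "inverse \<gamma>" \<nu>] assms
    by (simp add: D_def divide_inverse)
  hence *: "zak (sech_window \<gamma>) t \<nu> = of_real (2 powr (-1/2) * pi powr (1/2) * \<gamma>) * theta1' 0 (exp (- pi * \<gamma>))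
        * of_real (exp (- pi * \<gamma> * t\<^sup>2)) * (P / D)"
    using zak_sech_window_mult[OF assms, of t \<nu>] by (simp add: D_def P_def field_simps)
  \<comment> \<open>The factor \<open>(2 * \<gamma>) powr (1/4)\<close> is the normalisation of the
    Gaussian window, absorbed when \<open>theta3\<close> is replaced by the Zak transform.\<close>
  have "(\<gamma> / 2) powr (3/4) * (2 * \<gamma>) powr (1/4) = 2 powr (-1/2) * \<gamma>"
  proof -
    have "(\<gamma> / 2) powr (3/4) * (2 * \<gamma>) powr (1/4)
      = (\<gamma> powr (3/4) * \<gamma> powr (1/4)) * (2 powr (1/4) * 2 powr (-3/4))"
      using assms by (simp add: powr_mult powr_divide powr_minus_divide)
    also have "\<gamma> powr (3/4) * \<gamma> powr (1/4) = \<gamma>" using assms by (simp flip: powr_add)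
    also have "2 powr (1/4) * 2 powr (-3/4) = (2 :: real) powr (-1/2)" by (simp flip: powr_add)
    finally show ?thesis by simp
  qed
  hence const: "2 powr (-1/2) * pi powr (1/2) * \<gamma> = pi powr (1/2) * (\<gamma> / 2) powr (3/4) * (2 * \<gamma>) powr (1/4)"
    by (simp add: mult_ac)
  have **: "zak (sech_window \<gamma>) t \<nu>
      = of_real (pi powr (1/2) * (\<gamma> / 2) powr (3/4)) * theta1' 0 (exp (- pi * \<gamma>)) * (zak (gauss_window \<gamma>) t \<nu> / D)"
    unfolding * const zak_gauss_window P_def[symmetric] by (simp add: mult_ac)
  show "zak (sech_window \<gamma>) t \<nu>
      = of_real (2 powr (-1/2) * pi powr (1/2) * \<gamma>) * theta1' 0 (exp (- pi * \<gamma>))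
        * of_real (exp (- pi * \<gamma> * t\<^sup>2))
        * (theta3 (of_real pi * (of_real \<nu> - \<i> * of_real \<gamma> * of_real t)) (exp (- pi * \<gamma>))
           / (theta4 (of_real (pi * \<nu>)) (exp (- pi * \<gamma>))
              * theta4 (of_real (pi * t)) (exp (- pi / \<gamma>))))
    \<and> zak (sech_window \<gamma>) t \<nu>
      = of_real (pi powr (1/2) * (\<gamma> / 2) powr (3/4)) * theta1' 0 (exp (- pi * \<gamma>))
        * (zak (gauss_window \<gamma>) t \<nu>
           / (theta4 (of_real (pi * \<nu>)) (exp (- pi * \<gamma>))
              * theta4 (of_real (pi * t)) (exp (- pi / \<gamma>))))"
    using * ** unfolding D_def P_def by blast
qed

end
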